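(* Let $\alpha\in[0,\infty]$, $p\in(0,1)$ and $X\in\mathcal X_\alpha$. The following properties hold. 1. (Model-independence) $Q_\alpha(X;p)$ depends on $X$ only through the distribution of $X$. 2. (Monotonicity in $X$) $Q_\alpha(\cdot\,;p)$ is nondecreasing with respect to the stochastic dominance of order $\alpha+1$: for any $Y\in\mathcal X_\alpha$ such that $X\overset{\alpha+1}{\le}Y$, one has $Q_\alpha(X;p)\le Q_\alpha(Y;p)$. Therefore, $Q_\alpha(\cdot\,;p)$ is nondecreasing with respect to the stochastic dominance of any order $\gamma\in[1,\alpha+1]$; in particular, $Q_\alpha(X;p)\le Q_\alpha(Y;p)$ for any $Y\in\mathcal X_\alpha$ with $X\le Y$. 3. (Monotonicity in $\alpha$) $Q_\alpha(X;p)$ is nondecreasing in $\alpha$ (over those $\alpha\in[0,\infty]$ with $X\in\mathcal X_\alpha$). 4. (Monotonicity in $p$) $Q_\alpha(X;p)$ is nonincreasing in $p\in(0,1)$, and $Q_\alpha(X;p)$ is strictly decreasing in $p\in[p_*,1)\cap(0,1)$ if $\alpha\in(0,\infty]$. 5. (Finiteness) $Q_\alpha(X;p)$ takes only (finite) real values. 6. (Concavity in $p^{-1/\alpha}$ or in $\ln\frac1p$) $Q_\alpha(X;p)$ is concave in $p^{-1/\alpha}$ if $\alpha\in(0,\infty)$, and $Q_\infty(X;p)$ is concave in $\ln\frac1p$ if $\alpha=\infty$. 7. (Stability in $p$) $Q_\alpha(X;p)$ is continuous in $p\in(0,1)$ if $\alpha\in(0,\infty]$. 8. (Stability in $X$)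 Suppose that $\alpha\in(0,\infty]$ and that $(X_n)_{n\in\mathbb N}$ is a sequence of random variables in $\mathcal X_\alpha$ such that $X_n\to X$ in distribution and: $\sup_n\mathsf E(X_n)_+^\alpha\mathsf I\{X_n>N\}\to0$ as $N\to\infty$ if $\alpha\in(0,\infty)$; $\sup_n\mathsf E e^{\lambda X_n}\mathsf I\{X_n>N\}\to0$ as $N\to\infty$ for each $\lambda\in\Lambda_X$ if $\alpha=\infty$. Then $Q_\alpha(X_n;p)\to Q_\alpha(X;p)$. 9. (Stability in $\alpha$) Suppose that $\alpha\in(0,\infty]$ and that $(\alpha_n)$ is a sequence in $[0,\infty)$ converging to $\alpha$, with $\beta:=\sup_n\alpha_n$ and $X\in\mathcal X_\beta$. Then $Q_{\alpha_n}(X;p)\to Q_\alpha(X;p)$. 10. (Translation invariance) $Q_\alpha(X+c;p)=Q_\alpha(X;p)+c$ for all real $c$. 11. (Consistency) $Q_\alpha(c;p)=c$ for all real $c$ (where $c$ also denotes the constant random variable). 12. (Sensitivity) Suppose $X\ge0$. If $\mathsf P(X>0)>0$, then $Q_\alpha(X;p)>0$ for all $\alpha\in(0,\infty]$ (with $X\in\mathcal X_\alpha$); if, moreover, $\mathsf P(X>0)>p$, then $Q_0(X;p)>0$. 13. (Positive homogeneity) $Q_\alpha(\kappa X;p)=\kappa Q_\alpha(X;p)$ for all real $\kappa\ge0$. 14. (Subadditivity) If $\alpha\in[1,\infty]$, then for any other $Y\in\mathcal X_\alpha$ (defined on the same probability space as $X$), $Q_\alpha(X+Y;p)\le Q_\alpha(X;p)+Q_\alpha(Y;p)$.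 15. (Convexity) If $\alpha\in[1,\infty]$, then for any other $Y\in\mathcal X_\alpha$ (defined on the same probability space as $X$) and any $t\in(0,1)$, $Q_\alpha((1-t)X+tY;p)\le(1-t)Q_\alpha(X;p)+tQ_\alpha(Y;p)$.
   Context: For real $u$, $u_+:=\max(0,u)$ and $u_+^\alpha:=(u_+)^\alpha$. Define $h_\alpha:\mathbb R\to\mathbb R$ by $h_0(u)=\mathsf I\{u\ge0\}$ (indicator), $h_\alpha(u)=(1+u/\alpha)_+^\alpha$ for $0<\alpha<\infty$, and $h_\infty(u)=e^u$. For a random variable $X$, $x\in\mathbb R$, $\alpha\in[0,\infty]$ and $p\in(0,1)$ put $$P_\alpha(X;x):=\inf_{\lambda\in(0,\infty)}\mathsf E\,h_\alpha(\lambda(X-x)),\qquad Q_\alpha(X;p):=\inf\{x\in\mathbb R:P_\alpha(X;x)<p\}.$$ In particular, $P_0(X;x)=\mathsf P(X\ge x)$ and $Q_0(X;p)$ is the largest $(1-p)$-quantile of $X$. $\mathcal X_0$ is the set of all real-valued random variables (on a given probability space); for $\alpha\in(0,\infty)$, $\mathcal X_\alpha$ is the set of those $X$ with $\mathsf E X_+^\alpha<\infty$; $\Lambda_X:=\{\lambda\in(0,\infty):\mathsf E e^{\lambda X}<\infty\}$, and $\mathcal X_\infty$ is the set of those $X$ with $\Lambda_X\neq\emptyset$. $x_*:=\sup\operatorname{supp}X\in(-\infty,\infty]$ ($\operatorname{supp}X$ is the support of the distribution of $X$) and $p_*:=\mathsf P(X=x_* )$. Stochastic dominance: let $T_\alpha:=\mathbb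 R$ for $\alpha\in[0,\infty)$ and $T_\infty:=(0,\infty)$; let $g_{0;t}(u):=\mathsf I\{u>t\}$, $g_{\alpha;t}(u):=(u-t)_+^\alpha$ for $\alpha\in(0,\infty)$, $g_{\infty;t}(u):=e^{u/t}$. Let $\mathcal H^\alpha$ be the set of functions $g:\mathbb R\to\mathbb R$ of the form $g(u)=\int_{T_\alpha}g_{\alpha;t}(u)\,\mu(dt)$ for all $u\in\mathbb R$, where $\mu$ is a nonnegative Borel measure on $T_\alpha$. For random variables $X,Y$, $X\overset{\alpha+1}{\le}Y$ (stochastic dominance of order $\alpha+1$) means $\mathsf E g(X)\le\mathsf E g(Y)$ for all $g\in\mathcal H^\alpha$ (equivalently, $\mathsf E g_{\alpha;t}(X)\le\mathsf E g_{\alpha;t}(Y)$ for all $t\in T_\alpha$). Here $\infty+1:=\infty$. *)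

theory Defs
  imports "HOL-Probability.Probability"
begin

text \<open>The parameter \<open>\<alpha>\<close> ranges over \<open>[0, \<infinity>]\<close>, i.e. over the type \<^typ>\<open>ennreal\<close>; on \<open>(0, \<infinity>)\<close> its
  real value is \<open>enn2real \<alpha>\<close>.  Expectations of nonnegative quantities may be infinite (for instance
  \<open>E exp (\<lambda> X)\<close>) and are therefore written as nonnegative Lebesgue integrals.\<close>

definition pos_powr :: "real \<Rightarrow> real \<Rightarrow> real" where
  "pos_powr u a = (max 0 u) powr a"

definition h_fun :: "ennreal \<Rightarrow> real \<Rightarrow> real" where
  "h_fun \<alpha> u =
     (if \<alpha> = 0 then indicator {0..} u
      else if \<alpha> = \<infinity> then exp u
      else pos_powr (1 + u / enn2real \<alpha>) (enn2real \<alpha>))"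

definition P_bound :: "'a measure \<Rightarrow> ennreal \<Rightarrow> ('a \<Rightarrow> real) \<Rightarrow> real \<Rightarrow> ennreal" where
  "P_bound M \<alpha> X x = (INF l\<in>{0<..}. \<integral>\<^sup>+ \<omega>. ennreal (h_fun \<alpha> (l * (X \<omega> - x))) \<partial>M)"

text \<open>The infimum is taken in the extended reals, so that finiteness of the value is a genuine claim.\<close>

definition Q_bound :: "'a measure \<Rightarrow> ennreal \<Rightarrow> ('a \<Rightarrow> real) \<Rightarrow> real \<Rightarrow> ereal" where
  "Q_bound M \<alpha> X p = Inf (ereal ` {x. P_bound M \<alpha> X x < ennreal p})"

definition exp_moment_set :: "'a measure \<Rightarrow> ('a \<Rightarrow> real) \<Rightarrow> real set" where
  "exp_moment_set M X = {l. 0 < l \<and> (\<integral>\<^sup>+ \<omega>. ennreal (exp (l * X \<omega>)) \<partial>M) < \<infinity>}"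

definition rv_class :: "'a measure \<Rightarrow> ennreal \<Rightarrow> ('a \<Rightarrow> real) set" where
  "rv_class M \<alpha> =
     {X \<in> borel_measurable M.
        (0 < \<alpha> \<and> \<alpha> < \<infinity> \<longrightarrow> (\<integral>\<^sup>+ \<omega>. ennreal (pos_powr (X \<omega>) (enn2real \<alpha>)) \<partial>M) < \<infinity>) \<and>
        (\<alpha> = \<infinity> \<longrightarrow> exp_moment_set M X \<noteq> {})}"

definition supp_rv :: "'a measure \<Rightarrow> ('a \<Rightarrow> real) \<Rightarrow> real set" where
  "supp_rv M X = {x. \<forall>U. open U \<longrightarrow> x \<in> U \<longrightarrow> 0 < measure (distr M borel X) U}"

definition x_star :: "'a measure \<Rightarrow> ('a \<Rightarrow> real) \<Rightarrow> ereal" where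
  "x_star M X = Sup (ereal ` supp_rv M X)"

definition p_star :: "'a measure \<Rightarrow> ('a \<Rightarrow> real) \<Rightarrow> real" where
  "p_star M X = measure M {\<omega> \<in> space M. ereal (X \<omega>) = x_star M X}"

definition T_set :: "ennreal \<Rightarrow> real set" where
  "T_set \<alpha> = (if \<alpha> = \<infinity> then {0<..} else UNIV)"

definition g_fun :: "ennreal \<Rightarrow> real \<Rightarrow> real \<Rightarrow> real" where
  "g_fun \<alpha> t u =
     (if \<alpha> = 0 then indicator {t<..} u
      else if \<alpha> = \<infinity> then exp (u / t)
      else pos_powr (u - t) (enn2real \<alpha>))"

text \<open>The measures need not be finite or sigma-finite; only the resulting function has to be
  real-valued, which is why nonnegativity is required before passing to \<^typ>\<open>ennreal\<close>.\<close>

definition H_class :: "ennreal \<Rightarrow> (real \<Rightarrow> real) set" where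
  "H_class \<alpha> =
     {g. (\<forall>u. 0 \<le> g u) \<and>
         (\<exists>\<mu>. sets \<mu> = sets (restrict_space borel (T_set \<alpha>)) \<and>
              (\<forall>u. ennreal (g u) = (\<integral>\<^sup>+ t. ennreal (g_fun \<alpha> t u) \<partial>\<mu>)))}"

text \<open>Stochastic dominance of order \<open>\<gamma> = \<alpha> + 1 \<in> [1, \<infinity>]\<close>; in \<^typ>\<open>ennreal\<close> one has \<open>\<infinity> + 1 = \<infinity>\<close>,
  \<open>\<infinity> - 1 = \<infinity>\<close> and \<open>(\<alpha> + 1) - 1 = \<alpha>\<close>.  The two random variables may live on different
  probability spaces.\<close>

definition stoch_dom ::
  "ennreal \<Rightarrow> 'a measure \<Rightarrow> ('a \<Rightarrow> real) \<Rightarrow> 'b measure \<Rightarrow> ('b \<Rightarrow> real) \<Rightarrow> bool" where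
  "stoch_dom \<gamma> M X N Y \<longleftrightarrow>
     (\<forall>g \<in> H_class (\<gamma> - 1). (\<integral>\<^sup>+ \<omega>. ennreal (g (X \<omega>)) \<partial>M) \<le> (\<integral>\<^sup>+ \<omega>. ennreal (g (Y \<omega>)) \<partial>N))"

text \<open>\<open>F\<close> is concave in \<open>\<phi>\<close> on \<open>S\<close>: as a function of the new variable \<open>\<phi> q\<close>, \<open>F q\<close> is (real-valued
  and) concave.\<close>

definition concave_in :: "real set \<Rightarrow> (real \<Rightarrow> real) \<Rightarrow> (real \<Rightarrow> ereal) \<Rightarrow> bool" where
  "concave_in S \<phi> F \<longleftrightarrow> (\<exists>f. concave_on (\<phi> ` S) f \<and> (\<forall>q\<in>S. F q = ereal (f (\<phi> q))))"

text \<open>\<open>sup\<^sub>n E ((X\<^sub>n)\<^sub>+\<^sup>\<alpha> I{X\<^sub>n > K}) \<rightarrow> 0\<close> as \<open>K \<rightarrow> \<infinity>\<close>, and its exponential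
  counterpart; each \<open>X\<^sub>n\<close> lives on its own space \<open>N\<^sub>n\<close>.\<close>

definition unif_tail_powr :: "real \<Rightarrow> (nat \<Rightarrow> 'b measure) \<Rightarrow> (nat \<Rightarrow> 'b \<Rightarrow> real) \<Rightarrow> bool" where
  "unif_tail_powr a N Xs \<longleftrightarrow>
     ((\<lambda>K::real. SUP n. \<integral>\<^sup>+ \<omega>. ennreal (pos_powr (Xs n \<omega>) a * indicator {K<..} (Xs n \<omega>)) \<partial>(N n))
        \<longlongrightarrow> 0) at_top"

definition unif_tail_exp :: "real \<Rightarrow> (nat \<Rightarrow> 'b measure) \<Rightarrow> (nat \<Rightarrow> 'b \<Rightarrow> real) \<Rightarrow> bool" where
  "unif_tail_exp l N Xs \<longleftrightarrow>
     ((\<lambda>K::real. SUP n. \<integral>\<^sup>+ \<omega>. ennreal (exp (l * Xs n \<omega>) * indicator {K<..} (Xs n \<omega>)) \<partial>(N n))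
        \<longlongrightarrow> 0) at_top"

end

theory Submission
  imports Defs "HOL-Real_Asymp.Real_Asymp"
begin

text \<open>
  For finite \<open>\<alpha>\<close>, the substitution \<open>t = x - \<alpha> / l\<close> turns \<open>P_bound M \<alpha> X x < p\<close> into
  \<open>\<exists>t. t + N t * p powr (- 1 / \<alpha>) < x\<close>, where \<open>N t\<close> is the \<open>L\<^sup>\<alpha>\<close>-norm of the positive part of
  \<open>X - t\<close>, so that \<open>Q_bound M \<alpha> X p\<close> is an infimum of affine functions of \<open>p powr (- 1 / \<alpha>)\<close>; for
  \<open>\<alpha> = \<infinity>\<close> it is likewise the infimum over \<open>l\<close> of \<open>(ln (E exp (l X)) + ln (1 / p)) / l\<close>.  Concavity
  follows, and from it continuity and strict monotonicity in \<open>p\<close>, and sensitivity.  Subadditivity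
  comes from convexity of \<open>h_fun \<alpha>\<close> for \<open>\<alpha> \<ge> 1\<close>.  The stability statements combine an upper bound
  for one fixed scale \<open>l\<close> with a Fatou argument along nearly optimal scales, which have limit points
  in the compact interval \<open>[0, \<infinity>]\<close>.
\<close>

section \<open>The functions \<open>h_fun\<close>\<close>

text \<open>\<open>P_bound\<close> and \<open>Q_bound\<close> are infima that need not be attained,
  so the arguments run through the relation \<open>P_bound M \<alpha> X x < ennreal p\<close>, which
  says that some scale \<open>l\<close> works. Scales range over an open half-line and nearly
  optimal ones can escape from it; this is why limits in \<alpha> and X need more than convergence
  at a fixed scale. Fatou's lemma moreover weakens \<open>< p\<close> to \<open>\<le> p\<close>; the
  lost strictness is recovered from continuity in the level, so concavity and continuity have to
  come before stability.

  Concavity also excludes flat pieces. In the new variable the quantile bound is nondecreasing and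
  concave, so equal values at two levels bound it at all smaller levels, whereas small tail
  probabilities push it up unless X stays below that value almost surely.

  Dominance of order \<gamma> is tested only on mixtures of generators of order \<gamma>. Using it
  at order \<open>\<alpha> + 1\<close> requires every higher generator to be such a mixture; Euler's
  Beta and Gamma integrals supply the weights.\<close>

lemma h_fun_nonneg [simp]: "0 \<le> h_fun \<alpha> u"
  by (auto simp: h_fun_def pos_powr_def)

lemma h_fun_0 [simp]: "h_fun \<alpha> 0 = 1"
  by (auto simp: h_fun_def pos_powr_def)

lemma pos_powr_mono: "0 \<le> a \<Longrightarrow> u \<le> v \<Longrightarrow> pos_powr u a \<le> pos_powr v a"
  by (auto simp: pos_powr_def intro!: powr_mono2)

lemma pos_powr_scale:
  assumes "0 \<le> d" shows "pos_powr (d * u) a = d powr a * pos_powr u a"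
proof (cases "0 \<le> u")
  case False
  then have "d * u \<le> 0" using assms by (simp add: mult_nonneg_nonpos)
  then show ?thesis using False by (simp add: pos_powr_def max_def)
qed (use assms in \<open>simp add: pos_powr_def powr_mult\<close>)

lemma h_fun_mono: "u \<le> v \<Longrightarrow> h_fun \<alpha> u \<le> h_fun \<alpha> v"
  by (auto simp: h_fun_def indicator_def intro!: pos_powr_mono divide_right_mono)

lemma measurable_pos_powr [measurable]: "(\<lambda>u. pos_powr u a) \<in> borel_measurable borel"
  unfolding pos_powr_def by measurable

lemma measurable_h_fun [measurable]: "h_fun \<alpha> \<in> borel_measurable borel"
  by (intro borel_measurable_mono monoI h_fun_mono)

lemma measurable_g_fun [measurable]: "g_fun \<alpha> t \<in> borel_measurable borel"
  unfolding g_fun_def by (cases "\<alpha> = 0"; cases "\<alpha> = \<infinity>") simp_all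

lemma ennreal_pos_finiteE:
  fixes \<alpha> :: ennreal
  assumes "\<alpha> \<noteq> 0" "\<alpha> \<noteq> \<infinity>"
  obtains a where "0 < a" "\<alpha> = ennreal a" "enn2real \<alpha> = a"
  using assms by (cases \<alpha>) (auto simp: order_less_le)

lemma h_fun_finite: "0 < a \<Longrightarrow> h_fun (ennreal a) u = pos_powr (1 + u / a) a"
  by (auto simp: h_fun_def)

text \<open>The affine argument vanishes at \<open>x - a / l\<close>, so the scale factors out as a
  power. What remains is a generator \<open>g_fun\<close>; both the dominance argument and the
  affine representation in the level start from this form.\<close>

lemma h_fun_finite_shift:
  assumes "0 < a" "0 < l"
  shows "h_fun (ennreal a) (l * (u - x)) = (l / a) powr a * pos_powr (u - (x - a / l)) a"
proof -
  have "1 + l * (u - x) / a = (l / a) * (u - (x - a / l))"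
    using assms by (simp add: field_simps)
  then show ?thesis
    using assms pos_powr_scale[of "l / a"] by (simp add: h_fun_finite)
qed

lemma h_fun_infinity: "h_fun \<infinity> u = exp u"
  by (auto simp: h_fun_def)

lemma h_fun_zero: "h_fun 0 u = indicator {0..} u"
  by (auto simp: h_fun_def)

lemma pos_powr_le_exp:
  fixes a u :: real
  assumes "0 < a"
  shows "pos_powr (1 + u / a) a \<le> exp u"
proof -
  have "max 0 (1 + u / a) \<le> exp (u / a)"
    by (simp add: exp_ge_add_one_self add.commute)
  then have "pos_powr (1 + u / a) a \<le> exp (u / a) powr a"
    unfolding pos_powr_def using assms by (intro powr_mono2) auto
  then show ?thesis
    using assms by (simp add: exp_powr_real)
qed

text \<open>\<open>1 + u / b\<close> is the average of 1 and \<open>1 + u / a\<close> with weights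
  \<open>1 - a / b\<close> and \<open>a / b\<close>; concavity of the logarithm gives the inequality
  after multiplication by b.\<close>

lemma pos_powr_mono_exponent:
  fixes a b u :: real
  assumes "0 < a" "a \<le> b"
  shows "pos_powr (1 + u / a) a \<le> pos_powr (1 + u / b) b"
proof (cases "1 + u / a \<le> 0")
  case True
  then show ?thesis by (simp add: pos_powr_def)
next
  case False
  then have pos: "0 < 1 + u / a" by simp
  have eq: "1 + u / b = (1 - a / b) * 1 + (a / b) * (1 + u / a)"
    using assms by (simp add: field_simps)
  have t: "0 \<le> a / b" "a / b \<le> 1" using assms by auto
  have posb: "0 < 1 + u / b"
  proof -
    have "0 < (a / b) * (1 + u / a)" using pos assms by simp
    then show ?thesis unfolding eq using t by simp
  qed
  have "(a / b) * ln (1 + u / a) \<le> ln (1 + u / b)"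
    unfolding eq using concave_onD[OF ln_concave, of "a / b" 1 "1 + u / a"] t pos by simp
  then have "a * ln (1 + u / a) \<le> b * ln (1 + u / b)"
    using assms by (simp add: field_simps)
  then show ?thesis
    using pos posb by (simp add: pos_powr_def powr_def max_def)
qed

lemma h_fun_mono_index:
  assumes "\<alpha> \<le> \<beta>" shows "h_fun \<alpha> u \<le> h_fun \<beta> u"
proof (cases "\<alpha> = 0")
  case True
  show ?thesis
  proof (cases "0 \<le> u")
    case True
    then show ?thesis using h_fun_mono[of 0 u \<beta>] by (simp add: \<open>\<alpha> = 0\<close> h_fun_zero)
  qed (simp add: \<open>\<alpha> = 0\<close> h_fun_zero)
next
  case False
  show ?thesis
  proof (cases "\<beta> = \<infinity>")
    case inf: True
    show ?thesis
    proof (cases "\<alpha> = \<infinity>")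
      case False
      then obtain a where "0 < a" "\<alpha> = ennreal a" 
        using ennreal_pos_finiteE \<open>\<alpha> \<noteq> 0\<close> by metis
      then show ?thesis using inf
        by (simp add: h_fun_finite h_fun_infinity pos_powr_le_exp del: infinity_ennreal_def)
    qed (use inf in simp)
  next
    case fin: False
    then have "\<alpha> \<noteq> \<infinity>" "\<beta> \<noteq> 0" using False assms by (auto simp: top_unique)
    then obtain a b where "0 < a" "\<alpha> = ennreal a" "0 < b" "\<beta> = ennreal b"
      using ennreal_pos_finiteE False fin by metis
    then show ?thesis using assms
      by (simp add: h_fun_finite pos_powr_mono_exponent)
  qed
qed

lemma tendsto_h_fun_finite:
  fixes as :: "'c \<Rightarrow> ennreal"
  assumes "0 < a" "(as \<longlongrightarrow> ennreal a) F" "(u \<longlongrightarrow> v) F"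
  shows "((\<lambda>n. h_fun (as n) (u n)) \<longlongrightarrow> h_fun (ennreal a) v) F"
proof -
  have r: "((\<lambda>n. enn2real (as n)) \<longlongrightarrow> a) F"
    using tendsto_enn2real[OF assms(2)] \<open>0 < a\<close> by simp
  have "\<forall>\<^sub>F n in F. 0 < as n \<and> as n < \<infinity>"
    using order_tendstoD[OF assms(2)] \<open>0 < a\<close> by (simp add: eventually_conj)
  then have ev: "\<forall>\<^sub>F n in F. pos_powr (1 + u n / enn2real (as n)) (enn2real (as n)) = h_fun (as n) (u n)"
    by eventually_elim (auto simp: h_fun_def)
  \<comment> \<open>The base may tend to 0; the power is still continuous there because the limiting
    exponent is positive and the bases are nonnegative.\<close>
  have "((\<lambda>n. pos_powr (1 + u n / enn2real (as n)) (enn2real (as n))) \<longlongrightarrow> pos_powr (1 + v / a) a) F"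
    unfolding pos_powr_def using \<open>0 < a\<close>
    by (intro tendsto_powr' tendsto_intros r assms(3)) auto
  then show ?thesis
    using ev \<open>0 < a\<close> by (simp add: h_fun_finite filterlim_cong)
qed

text \<open>For infinite \<alpha>, monotonicity in the index squeezes the sequence: from below by a
  fixed finite index a for which \<open>(1 + v / a) powr a\<close> is close to \<open>exp v\<close>,
  from above by \<open>exp\<close> itself.\<close>

lemma tendsto_h_fun:
  fixes as :: "'c \<Rightarrow> ennreal"
  assumes "0 < \<alpha>" "(as \<longlongrightarrow> \<alpha>) F" "(u \<longlongrightarrow> v) F"
  shows "((\<lambda>n. h_fun (as n) (u n)) \<longlongrightarrow> h_fun \<alpha> v) F"
proof (cases "\<alpha> = \<infinity>")
  case False
  then obtain a where "0 < a" "\<alpha> = ennreal a"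
    using ennreal_pos_finiteE assms(1) by (metis less_irrefl)
  then show ?thesis using tendsto_h_fun_finite assms by blast
next
  case True
  show ?thesis
  proof (rule order_tendstoI)
    fix c assume "c < h_fun \<alpha> v"
    then have "c < exp v" by (simp add: True h_fun_infinity del: infinity_ennreal_def)
    with tendsto_exp_limit_at_top[of v]
    have "\<forall>\<^sub>F y in at_top. c < (1 + v / y) powr y" by (auto dest: order_tendstoD)
    then have "\<forall>\<^sub>F y in at_top. c < (1 + v / y) powr y \<and> 0 < y \<and> \<bar>v\<bar> < y"
      by (intro eventually_conj eventually_gt_at_top)
    then obtain a where a: "c < (1 + v / a) powr a" "0 < a" "\<bar>v\<bar> < a"
      using eventually_happens' trivial_limit_at_top_linorder by blast
    moreover have "0 \<le> 1 + v / a" using a(2,3) by (simp add: field_simps)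
    ultimately have "c < h_fun (ennreal a) v" by (simp add: h_fun_finite pos_powr_def)
    then have ev: "\<forall>\<^sub>F n in F. c < h_fun (ennreal a) (u n)"
      using tendsto_h_fun_finite[OF a(2) tendsto_const assms(3)] by (auto dest: order_tendstoD)
    have "\<forall>\<^sub>F n in F. ennreal a < as n" using order_tendstoD(1)[OF assms(2), of "ennreal a"] True by simp
    with ev show "\<forall>\<^sub>F n in F. c < h_fun (as n) (u n)"
      by eventually_elim (meson h_fun_mono_index less_imp_le less_le_trans)
  next
    fix c assume "h_fun \<alpha> v < c"
    then have "exp v < c" by (simp add: True h_fun_infinity del: infinity_ennreal_def)
    with tendsto_exp[OF assms(3)] have "\<forall>\<^sub>F n in F. exp (u n) < c" by (auto dest: order_tendstoD)
    then show "\<forall>\<^sub>F n in F. h_fun (as n) (u n) < c"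
      by eventually_elim
        (metis h_fun_infinity h_fun_mono_index infinity_ennreal_def le_less_trans top_greatest)
  qed
qed

lemma h_fun_tendsto_0: "(h_fun \<alpha> \<longlongrightarrow> 0) at_bot"
proof (rule tendsto_sandwich)
  show "\<forall>\<^sub>F u in at_bot. h_fun \<alpha> u \<le> exp u"
    by (intro always_eventually allI) (metis h_fun_infinity h_fun_mono_index infinity_ennreal_def top_greatest)
  show "((\<lambda>x. 0) \<longlongrightarrow> 0) at_bot" by simp
  show "(exp \<longlongrightarrow> (0::real)) at_bot" by (rule exp_at_bot)
qed simp

lemma filterlim_h_fun_at_top:
  assumes "0 < a" shows "filterlim (h_fun (ennreal a)) at_top at_top"
proof -
  have "filterlim (\<lambda>u. (1 + u / a) powr a) at_top at_top"
    using assms by real_asymp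
  moreover have "\<forall>\<^sub>F u in at_top. (1 + u / a) powr a = h_fun (ennreal a) u"
    using eventually_ge_at_top[of 0] by eventually_elim (use assms in \<open>simp add: h_fun_finite pos_powr_def\<close>)
  ultimately show ?thesis by (simp add: filterlim_cong)
qed

lemma convex_pos_powr:
  assumes "1 \<le> a" shows "convex_on UNIV (\<lambda>u. pos_powr u a)"
proof (rule convex_onI)
  fix t x y :: real
  assume t: "0 < t" "t < 1"
  \<comment> \<open>When an endpoint is 0 the claim reduces to \<open>s powr a \<le> s\<close> for
    \<open>0 < s < 1\<close>, which is where \<open>1 \<le> a\<close> enters.\<close>
  have key: "((1 - t) * v + t * w) powr a \<le> (1 - t) * v powr a + t * w powr a" if nn: "0 \<le> v" "0 \<le> w" for v w
  proof -
    have sub: "s powr a \<le> s" if "0 < s" "s < 1" for s :: real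
      using powr_mono'[of 1 a s] assms that by simp
    consider "0 < v" "0 < w" | "v = 0" | "w = 0" using nn by fastforce
    then show ?thesis
    proof cases
      case 1
      then show ?thesis using convex_onD[OF powr_convex[OF assms], of t v w] t by simp
    next
      case 2
      then show ?thesis using sub[of t] t that by (simp add: powr_mult mult_right_mono)
    next
      case 3
      then show ?thesis using sub[of "1 - t"] t that by (simp add: powr_mult mult_right_mono)
    qed
  qed
  have "max 0 ((1 - t) * x + t * y) \<le> (1 - t) * max 0 x + t * max 0 y"
    using t by (intro max.boundedI add_mono mult_left_mono) auto
  then have "pos_powr ((1 - t) * x + t * y) a \<le> ((1 - t) * max 0 x + t * max 0 y) powr a"
    unfolding pos_powr_def using assms by (intro powr_mono2) auto
  also have "\<dots> \<le> (1 - t) * pos_powr x a + t * pos_powr y a"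
    unfolding pos_powr_def by (intro key) auto
  finally show "pos_powr ((1 - t) *\<^sub>R x + t *\<^sub>R y) a \<le> (1 - t) * pos_powr x a + t * pos_powr y a"
    by simp
qed simp

lemma convex_h_fun:
  assumes "1 \<le> \<alpha>" "0 \<le> s" "0 \<le> t" "s + t = 1"
  shows "h_fun \<alpha> (s * x + t * y) \<le> s * h_fun \<alpha> x + t * h_fun \<alpha> y"
proof (cases "\<alpha> = \<infinity>")
  case True
  have s: "s = 1 - t" using assms by simp
  show ?thesis
    using convex_onD[OF exp_convex, of t x y] assms True s
    by (simp add: h_fun_infinity del: infinity_ennreal_def)
next
  case False
  then obtain a where a: "0 < a" "\<alpha> = ennreal a"
    using ennreal_pos_finiteE assms(1) by (metis not_one_le_zero)
  then have "1 \<le> a" using assms(1) by simp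
  have s: "s = 1 - t" using assms by simp
  have "1 + (s * x + t * y) / a = s * (1 + x / a) + t * (1 + y / a)"
    using a(1) by (simp add: s field_simps)
  then show ?thesis
    using convex_onD[OF convex_pos_powr[OF \<open>1 \<le> a\<close>], of t "1 + x / a" "1 + y / a"] assms
    by (simp add: a h_fun_finite s)
qed

section \<open>Tail bounds and quantile bounds\<close>

lemma P_bound_less_iff:
  "P_bound M \<alpha> X x < c \<longleftrightarrow>
     (\<exists>l>0. (\<integral>\<^sup>+ \<omega>. ennreal (h_fun \<alpha> (l * (X \<omega> - x))) \<partial>M) < c)"
  unfolding P_bound_def INF_less_iff by auto

lemma P_bound_antimono: "x \<le> y \<Longrightarrow> P_bound M \<alpha> X y \<le> P_bound M \<alpha> X x"
  unfolding P_bound_def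
  by (intro INF_superset_mono order_refl nn_integral_mono ennreal_leI h_fun_mono)
    (auto simp: mult_left_mono)

lemma P_bound_mono_index: "\<alpha> \<le> \<beta> \<Longrightarrow> P_bound M \<alpha> X x \<le> P_bound M \<beta> X x"
  unfolding P_bound_def
  by (intro INF_mono' nn_integral_mono ennreal_leI h_fun_mono_index)

lemma P_bound_mono_AE:
  assumes "AE \<omega> in M. X \<omega> \<le> Y \<omega>"
  shows "P_bound M \<alpha> X x \<le> P_bound M \<alpha> Y x"
  unfolding P_bound_def
proof (rule INF_mono, rule bexI)
  fix l :: real assume "l \<in> {0<..}"
  then have "AE \<omega> in M. ennreal (h_fun \<alpha> (l * (X \<omega> - x))) \<le> ennreal (h_fun \<alpha> (l * (Y \<omega> - x)))"
    using assms by (auto intro!: ennreal_leI h_fun_mono)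
  then show "(\<integral>\<^sup>+ \<omega>. ennreal (h_fun \<alpha> (l * (X \<omega> - x))) \<partial>M)
      \<le> (\<integral>\<^sup>+ \<omega>. ennreal (h_fun \<alpha> (l * (Y \<omega> - x))) \<partial>M)"
    by (rule nn_integral_mono_AE)
qed

section \<open>Dependence on the law alone\<close>

lemma nn_integral_distr_eq:
  assumes "Y \<in> borel_measurable N" "X \<in> borel_measurable M" "distr N borel Y = distr M borel X"
    and "f \<in> borel_measurable borel"
  shows "(\<integral>\<^sup>+ \<omega>. f (Y \<omega>) \<partial>N) = (\<integral>\<^sup>+ \<omega>. f (X \<omega>) \<partial>M)"
  using assms(3) nn_integral_distr[OF assms(1), of f] nn_integral_distr[OF assms(2), of f] assms(4)
  by simp

lemma P_bound_distr_eq: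
  assumes "Y \<in> borel_measurable N" "X \<in> borel_measurable M" "distr N borel Y = distr M borel X"
  shows "P_bound N \<alpha> Y = P_bound M \<alpha> X"
  unfolding P_bound_def
  by (intro ext INF_cong refl nn_integral_distr_eq[OF assms]) measurable

lemma Q_bound_distr_eq:
  assumes "Y \<in> borel_measurable N" "X \<in> borel_measurable M" "distr N borel Y = distr M borel X"
  shows "Q_bound N \<alpha> Y p = Q_bound M \<alpha> X p"
  unfolding Q_bound_def P_bound_distr_eq[OF assms] ..

lemma rv_class_distr_eq:
  assumes "Y \<in> borel_measurable N" "X \<in> rv_class M \<alpha>" "distr N borel Y = distr M borel X"
  shows "Y \<in> rv_class N \<alpha>"
proof -
  have X: "X \<in> borel_measurable M" using assms(2) by (simp add: rv_class_def)
  have "(\<integral>\<^sup>+ \<omega>. ennreal (pos_powr (Y \<omega>) a) \<partial>N) = (\<integral>\<^sup>+ \<omega>. ennreal (pos_powr (X \<omega>) a) \<partial>M)" for a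
    by (rule nn_integral_distr_eq[OF assms(1) X assms(3)]) measurable
  moreover have "exp_moment_set N Y = exp_moment_set M X"
    unfolding exp_moment_set_def
    by (subst nn_integral_distr_eq[OF assms(1) X assms(3)]) simp_all
  ultimately show ?thesis using assms(1,2) by (simp add: rv_class_def)
qed

section \<open>Quantile bounds and sublevel sets of the tail bound\<close>

lemma Q_bound_le: "P_bound M \<alpha> X x < ennreal p \<Longrightarrow> Q_bound M \<alpha> X p \<le> ereal x"
  unfolding Q_bound_def by (auto intro: INF_lower)

lemma Q_bound_geI:
  "(\<And>x. P_bound M \<alpha> X x < ennreal p \<Longrightarrow> c \<le> ereal x) \<Longrightarrow> c \<le> Q_bound M \<alpha> X p"
  unfolding Q_bound_def by (auto intro: INF_greatest)

lemma Q_bound_lessD: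
  assumes "Q_bound M \<alpha> X p < ereal x" shows "P_bound M \<alpha> X x < ennreal p"
proof -
  obtain y where "P_bound M \<alpha> X y < ennreal p" "y < x"
    using assms unfolding Q_bound_def Inf_less_iff by auto
  then show ?thesis using P_bound_antimono[of y x] by (meson le_less_trans less_imp_le)
qed

text \<open>The sublevel set is closed upwards, but its infimum need not belong to it; hence only
  points strictly above x are controlled.\<close>

lemma Q_bound_le_iff:
  "Q_bound M \<alpha> X p \<le> ereal x \<longleftrightarrow> (\<forall>y>x. P_bound M \<alpha> X y < ennreal p)"
proof
  assume "Q_bound M \<alpha> X p \<le> ereal x"
  then show "\<forall>y>x. P_bound M \<alpha> X y < ennreal p"
    by (auto intro!: Q_bound_lessD elim: le_less_trans)
next
  assume *: "\<forall>y>x. P_bound M \<alpha> X y < ennreal p"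
  show "Q_bound M \<alpha> X p \<le> ereal x"
    by (rule ereal_le_epsilon2) (use * in \<open>auto intro!: Q_bound_le\<close>)
qed

lemma Q_bound_mono:
  "(\<And>x. P_bound N \<beta> Y x < ennreal q \<Longrightarrow> P_bound M \<alpha> X x < ennreal p) \<Longrightarrow>
    Q_bound M \<alpha> X p \<le> Q_bound N \<beta> Y q"
  by (rule Q_bound_geI) (rule Q_bound_le)

lemma Q_bound_mono_P:
  "(\<And>x. P_bound M \<alpha> X x \<le> P_bound N \<beta> Y x) \<Longrightarrow> Q_bound M \<alpha> X p \<le> Q_bound N \<beta> Y p"
  by (rule Q_bound_mono) (rule le_less_trans)

lemma Q_bound_antimono: "p \<le> q \<Longrightarrow> Q_bound M \<alpha> X q \<le> Q_bound M \<alpha> X p"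
  by (rule Q_bound_mono) (auto intro: less_le_trans ennreal_leI)

lemma Q_bound_mono_index: "\<alpha> \<le> \<beta> \<Longrightarrow> Q_bound M \<alpha> X p \<le> Q_bound M \<beta> X p"
  by (intro Q_bound_mono_P P_bound_mono_index)

lemma Q_bound_mono_AE:
  "AE \<omega> in M. X \<omega> \<le> Y \<omega> \<Longrightarrow> Q_bound M \<alpha> X p \<le> Q_bound M \<alpha> Y p"
  by (intro Q_bound_mono_P P_bound_mono_AE)

text \<open>For \<open>\<alpha> = 0\<close> the integrand sees only the sign of
  \<open>X \<omega> - x\<close>, which no positive scale changes, so the infimum runs over a
  constant.\<close>

lemma P_bound_zero:
  assumes "X \<in> borel_measurable M"
  shows "P_bound M 0 X x = emeasure M {\<omega> \<in> space M. x \<le> X \<omega>}"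
proof -
  have "(\<integral>\<^sup>+ \<omega>. ennreal (h_fun 0 (l * (X \<omega> - x))) \<partial>M) = emeasure M {\<omega> \<in> space M. x \<le> X \<omega>}"
    if "0 < l" for l :: real
  proof -
    have "(\<integral>\<^sup>+ \<omega>. ennreal (h_fun 0 (l * (X \<omega> - x))) \<partial>M)
        = (\<integral>\<^sup>+ \<omega>. indicator {\<omega> \<in> space M. x \<le> X \<omega>} \<omega> \<partial>M)"
      using that by (intro nn_integral_cong) (auto simp: h_fun_zero indicator_def zero_le_mult_iff)
    also have "\<dots> = emeasure M {\<omega> \<in> space M. x \<le> X \<omega>}"
      using assms by (intro nn_integral_indicator) measurable
    finally show ?thesis .
  qed
  then show ?thesis unfolding P_bound_def by (simp add: cong: INF_cong_simp)
qed

section \<open>Translation, constants, scaling and sums\<close>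

lemma Q_bound_translate: "Q_bound M \<alpha> (\<lambda>\<omega>. X \<omega> + c) p = Q_bound M \<alpha> X p + ereal c"
proof -
  have P: "P_bound M \<alpha> (\<lambda>\<omega>. X \<omega> + c) x = P_bound M \<alpha> X (x - c)" for X c x
    unfolding P_bound_def by (simp add: algebra_simps)
  have le: "Q_bound M \<alpha> (\<lambda>\<omega>. X \<omega> + c) p \<le> Q_bound M \<alpha> X p + ereal c" for X c
  proof -
    have "Q_bound M \<alpha> (\<lambda>\<omega>. X \<omega> + c) p - ereal c \<le> Q_bound M \<alpha> X p"
    proof (rule Q_bound_geI)
      fix x assume "P_bound M \<alpha> X x < ennreal p"
      then have "Q_bound M \<alpha> (\<lambda>\<omega>. X \<omega> + c) p \<le> ereal (x + c)"
        by (intro Q_bound_le) (simp add: P)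
      then show "Q_bound M \<alpha> (\<lambda>\<omega>. X \<omega> + c) p - ereal c \<le> ereal x"
        by (simp add: ereal_minus_le)
    qed
    then show ?thesis by (simp add: ereal_minus_le)
  qed
  \<comment> \<open>The reverse inequality is the same one applied to the translated variable and
    shifted back by \<open>- c\<close>.\<close>
  have "Q_bound M \<alpha> X p \<le> Q_bound M \<alpha> (\<lambda>\<omega>. X \<omega> + c) p + ereal (- c)"
    using le[of "\<lambda>\<omega>. X \<omega> + c" "- c"] by simp
  then have "Q_bound M \<alpha> X p + ereal c \<le> Q_bound M \<alpha> (\<lambda>\<omega>. X \<omega> + c) p"
    by (cases "Q_bound M \<alpha> X p"; cases "Q_bound M \<alpha> (\<lambda>\<omega>. X \<omega> + c) p") auto
  with le[of X c] show ?thesis by simp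
qed

lemma P_bound_ge_1_const:
  assumes "prob_space M" "x \<le> c" shows "1 \<le> P_bound M \<alpha> (\<lambda>\<omega>. c) x"
  unfolding P_bound_def
proof (rule INF_greatest)
  interpret prob_space M by fact
  fix l :: real assume "l \<in> {0<..}"
  then have "h_fun \<alpha> 0 \<le> h_fun \<alpha> (l * (c - x))" using assms(2) by (intro h_fun_mono) simp
  then show "1 \<le> (\<integral>\<^sup>+ \<omega>. ennreal (h_fun \<alpha> (l * (c - x))) \<partial>M)"
    by (simp add: emeasure_space_1)
qed

text \<open>As \<open>c < x\<close>, letting the scale tend to infinity drives the argument to minus
  infinity, where \<open>h_fun \<alpha>\<close> vanishes.\<close>

lemma P_bound_const:
  assumes "prob_space M" "c < x" "0 < p" shows "P_bound M \<alpha> (\<lambda>\<omega>. c) x < ennreal p"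
proof -
  interpret prob_space M by fact
  have "filterlim (\<lambda>l. (c - x) * l) at_bot at_top"
    using assms(2) by (intro filterlim_tendsto_neg_mult_at_bot[OF tendsto_const] filterlim_ident) simp
  then have "((\<lambda>l. h_fun \<alpha> ((c - x) * l)) \<longlongrightarrow> 0) at_top"
    by (rule filterlim_compose[OF h_fun_tendsto_0])
  then have "\<forall>\<^sub>F l in at_top. h_fun \<alpha> ((c - x) * l) < p \<and> 0 < l"
    using assms(3) by (intro eventually_conj eventually_gt_at_top) (auto dest: order_tendstoD)
  then obtain l where "h_fun \<alpha> ((c - x) * l) < p" "0 < l"
    using eventually_happens' trivial_limit_at_top_linorder by blast
  then show ?thesis unfolding P_bound_less_iff using assms(3)
    by (intro exI[of _ l]) (simp add: emeasure_space_1 ennreal_less_iff mult.commute)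
qed

lemma Q_bound_const:
  assumes "prob_space M" "0 < p" "p < 1"
  shows "Q_bound M \<alpha> (\<lambda>\<omega>. c) p = ereal c"
proof (rule antisym)
  show "Q_bound M \<alpha> (\<lambda>\<omega>. c) p \<le> ereal c"
    unfolding Q_bound_le_iff using P_bound_const assms by blast
  show "ereal c \<le> Q_bound M \<alpha> (\<lambda>\<omega>. c) p"
  proof (rule Q_bound_geI)
    fix x assume *: "P_bound M \<alpha> (\<lambda>\<omega>. c) x < ennreal p"
    also have "\<dots> < ennreal 1" using assms by (intro ennreal_lessI) auto
    finally show "ereal c \<le> ereal x" 
      using P_bound_ge_1_const[OF assms(1), of x c \<alpha>] by force
  qed
qed

lemma Q_bound_scale_pos:
  assumes "0 < k"
  shows "Q_bound M \<alpha> (\<lambda>\<omega>. k * X \<omega>) p = ereal k * Q_bound M \<alpha> X p"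
proof -
  have le: "Q_bound M \<alpha> (\<lambda>\<omega>. k * X \<omega>) p \<le> ereal k * Q_bound M \<alpha> X p" if "0 < k" for X k
  proof -
    have "Q_bound M \<alpha> (\<lambda>\<omega>. k * X \<omega>) p / ereal k \<le> Q_bound M \<alpha> X p"
    proof (rule Q_bound_geI)
      fix x assume "P_bound M \<alpha> X x < ennreal p"
      then obtain l where l: "0 < l" "(\<integral>\<^sup>+ \<omega>. ennreal (h_fun \<alpha> (l * (X \<omega> - x))) \<partial>M) < ennreal p"
        unfolding P_bound_less_iff by blast
      have "(l / k) * (k * X \<omega> - k * x) = l * (X \<omega> - x)" for \<omega>
        using that by (simp add: field_simps)
      then have "P_bound M \<alpha> (\<lambda>\<omega>. k * X \<omega>) (k * x) < ennreal p"
        unfolding P_bound_less_iff using l that by (intro exI[of _ "l / k"]) simp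
      then have "Q_bound M \<alpha> (\<lambda>\<omega>. k * X \<omega>) p \<le> ereal (k * x)" by (rule Q_bound_le)
      then show "Q_bound M \<alpha> (\<lambda>\<omega>. k * X \<omega>) p / ereal k \<le> ereal x"
        using that by (simp add: ereal_divide_le_pos)
    qed
    then show ?thesis using that by (simp add: ereal_divide_le_pos)
  qed
  have "Q_bound M \<alpha> (\<lambda>\<omega>. (1 / k) * (k * X \<omega>)) p \<le> ereal (1 / k) * Q_bound M \<alpha> (\<lambda>\<omega>. k * X \<omega>) p"
    using assms by (intro le) simp
  then have "Q_bound M \<alpha> X p \<le> Q_bound M \<alpha> (\<lambda>\<omega>. k * X \<omega>) p / ereal k"
    using assms by (simp add: divide_ereal_def mult.commute field_simps)
  then have "ereal k * Q_bound M \<alpha> X p \<le> Q_bound M \<alpha> (\<lambda>\<omega>. k * X \<omega>) p"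
    using assms by (simp add: ereal_le_divide_pos)
  with le[OF assms, of X] show ?thesis by simp
qed

text \<open>By convexity of \<open>h_fun \<alpha>\<close>: if \<open>l\<close> and \<open>m\<close> witness the bounds for \<open>X\<close> and \<open>Y\<close>, their
  harmonic combination \<open>l m / (l + m)\<close> witnesses the bound for the sum.\<close>

lemma P_bound_add:
  assumes "1 \<le> \<alpha>" and [measurable]: "X \<in> borel_measurable M" "Y \<in> borel_measurable M"
    and "P_bound M \<alpha> X x < ennreal p" "P_bound M \<alpha> Y y < ennreal p"
  shows "P_bound M \<alpha> (\<lambda>\<omega>. X \<omega> + Y \<omega>) (x + y) < ennreal p"
proof -
  obtain l where l: "0 < l" "(\<integral>\<^sup>+ \<omega>. ennreal (h_fun \<alpha> (l * (X \<omega> - x))) \<partial>M) < ennreal p" (is "?IX < _")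
    using assms(4) unfolding P_bound_less_iff by blast
  obtain m where m: "0 < m" "(\<integral>\<^sup>+ \<omega>. ennreal (h_fun \<alpha> (m * (Y \<omega> - y))) \<partial>M) < ennreal p" (is "?IY < _")
    using assms(5) unfolding P_bound_less_iff by blast
  \<comment> \<open>The weights are crossed: \<open>s\<close> carries \<open>m\<close> and
    \<open>t\<close> carries \<open>l\<close>, so that \<open>s * l = t * m\<close> is one scale
    common to both summands.\<close>
  define s where "s = m / (l + m)"
  define t where "t = l / (l + m)"
  have st: "0 < s" "0 < t" "s + t = 1" using l m by (auto simp: s_def t_def add_divide_distrib[symmetric])
  define n where "n = l * m / (l + m)"
  have n: "0 < n" "n = s * l" "n = t * m" using l m by (auto simp: n_def s_def t_def)
  have "(\<integral>\<^sup>+ \<omega>. ennreal (h_fun \<alpha> (n * (X \<omega> + Y \<omega> - (x + y)))) \<partial>M)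
      \<le> (\<integral>\<^sup>+ \<omega>. ennreal s * ennreal (h_fun \<alpha> (l * (X \<omega> - x)))
             + ennreal t * ennreal (h_fun \<alpha> (m * (Y \<omega> - y))) \<partial>M)"
  proof (rule nn_integral_mono)
    fix \<omega>
    have "n * (X \<omega> + Y \<omega> - (x + y)) = n * (X \<omega> - x) + n * (Y \<omega> - y)" by (simp add: algebra_simps)
    also have "\<dots> = s * (l * (X \<omega> - x)) + t * (m * (Y \<omega> - y))"
      by (metis n(2,3) mult.assoc)
    finally have "h_fun \<alpha> (n * (X \<omega> + Y \<omega> - (x + y)))
        \<le> s * h_fun \<alpha> (l * (X \<omega> - x)) + t * h_fun \<alpha> (m * (Y \<omega> - y))"
      using convex_h_fun[OF assms(1), of s t] st by simp
    then show "ennreal (h_fun \<alpha> (n * (X \<omega> + Y \<omega> - (x + y))))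
        \<le> ennreal s * ennreal (h_fun \<alpha> (l * (X \<omega> - x)))
             + ennreal t * ennreal (h_fun \<alpha> (m * (Y \<omega> - y)))"
      using st by (simp add: ennreal_leI flip: ennreal_mult ennreal_plus)
  qed
  also have "\<dots> = ennreal s * ?IX + ennreal t * ?IY"
    by (simp add: nn_integral_add nn_integral_cmult)
  also have "\<dots> < ennreal p"
  proof -
    obtain a b where ab: "?IX = ennreal a" "?IY = ennreal b" "0 \<le> a" "0 \<le> b" "a < p" "b < p"
      using l(2) m(2) by (cases ?IX; cases ?IY) (auto simp: ennreal_less_iff)
    have "s * a + t * b < s * p + t * p" using st ab by (intro add_strict_mono) auto
    also have "\<dots> = p" using st by (simp flip: distrib_right)
    finally show ?thesis using ab st
      by (simp add: ennreal_less_iff flip: ennreal_mult ennreal_plus)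
  qed
  finally show ?thesis unfolding P_bound_less_iff using n(1) by blast
qed

section \<open>Stochastic dominance\<close>

lemma measurable_g_fun_param: "(\<lambda>t. g_fun \<alpha> t u) \<in> borel_measurable borel"
proof -
  have "(\<lambda>t. indicator {t<..} u :: real) = indicator {..<u}" by (auto simp: indicator_def)
  then show ?thesis unfolding g_fun_def by (cases "\<alpha> = 0"; cases "\<alpha> = \<infinity>") simp_all
qed

lemma g_fun_nonneg [simp]: "0 \<le> g_fun \<alpha> t u"
  by (auto simp: g_fun_def pos_powr_def)

text \<open>At \<open>b = 0\<close> the convention \<open>0 powr 0 = 0\<close> turns
  \<open>pos_powr\<close> into the indicator of \<open>t < u\<close>, so order zero fits the same
  formula.\<close>

lemma g_fun_finite: "0 \<le> b \<Longrightarrow> g_fun (ennreal b) t u = pos_powr (u - t) b"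
  by (auto simp: g_fun_def pos_powr_def indicator_def)

text \<open>A generator is the mixture with respect to the point mass at t. The mass is placed on
  the restricted space since \<open>H_class\<close> prescribes that sigma-algebra.\<close>

lemma stoch_dom_g_fun:
  assumes "stoch_dom (\<alpha> + 1) M X N Y" "t \<in> T_set \<alpha>"
  shows "(\<integral>\<^sup>+ \<omega>. ennreal (g_fun \<alpha> t (X \<omega>)) \<partial>M) \<le> (\<integral>\<^sup>+ \<omega>. ennreal (g_fun \<alpha> t (Y \<omega>)) \<partial>N)"
proof -
  let ?\<mu> = "return (restrict_space borel (T_set \<alpha>)) t"
  have "ennreal (g_fun \<alpha> t u) = (\<integral>\<^sup>+ s. ennreal (g_fun \<alpha> s u) \<partial>?\<mu>)" for u
    using assms(2)
    by (subst nn_integral_return)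
      (auto simp: space_restrict_space intro!: measurable_restrict_space1 measurable_g_fun_param
        measurable_compose[OF _ measurable_ennreal])
  then have "g_fun \<alpha> t \<in> H_class \<alpha>"
    unfolding H_class_def by (auto intro!: exI[of _ ?\<mu>])
  then show ?thesis using assms(1) by (simp add: stoch_dom_def ennreal_add_diff_cancel_right)
qed

text \<open>A mixture of the generators of order \<open>\<beta>\<close> may be a positive multiple of a generator of higher
  order; this transfers dominance from order \<open>\<beta> + 1\<close> to higher orders.\<close>

lemma stoch_dom_mixture:
  fixes f :: "real \<Rightarrow> real"
  assumes dom: "stoch_dom (ennreal b + 1) M X N Y" and "0 \<le> b"
    and [measurable]: "X \<in> borel_measurable M" "Y \<in> borel_measurable N"
      "w \<in> borel_measurable borel" "f \<in> borel_measurable borel"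
    and "0 < C" "C < \<infinity>" "\<And>u. 0 \<le> f u"
    and mix: "\<And>u. (\<integral>\<^sup>+ s. w s * ennreal (pos_powr (u - s) b) \<partial>lborel) = C * ennreal (f u)"
  shows "(\<integral>\<^sup>+ \<omega>. ennreal (f (X \<omega>)) \<partial>M) \<le> (\<integral>\<^sup>+ \<omega>. ennreal (f (Y \<omega>)) \<partial>N)"
proof -
  obtain c where c: "0 < c" "C = ennreal c" using assms by (cases C) (auto simp: order_less_le)
  let ?\<mu> = "density lborel w"
  have "ennreal (c * f u) = (\<integral>\<^sup>+ s. ennreal (g_fun (ennreal b) s u) \<partial>?\<mu>)" for u
    using \<open>0 \<le> b\<close> c
    by (subst nn_integral_density) (simp_all add: g_fun_finite mix ennreal_mult')
  then have "(\<lambda>u. c * f u) \<in> H_class (ennreal b)"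
    unfolding H_class_def using c assms(9)
    by (auto intro!: exI[of _ ?\<mu>] simp: T_set_def)
  then have "(\<integral>\<^sup>+ \<omega>. ennreal (c * f (X \<omega>)) \<partial>M) \<le> (\<integral>\<^sup>+ \<omega>. ennreal (c * f (Y \<omega>)) \<partial>N)"
    using dom unfolding stoch_dom_def by (auto simp: ennreal_add_diff_cancel_right)
  then have "C * (\<integral>\<^sup>+ \<omega>. ennreal (f (X \<omega>)) \<partial>M) \<le> C * (\<integral>\<^sup>+ \<omega>. ennreal (f (Y \<omega>)) \<partial>N)"
    using c by (simp add: ennreal_mult' nn_integral_cmult)
  then show ?thesis using assms(7,8) by (simp add: ennreal_mult_le_mult_iff)
qed

section \<open>Higher generators as mixtures of lower ones\<close>

lemma nn_integral_Beta:
  assumes "0 < a" "0 < b"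
  shows "(\<integral>\<^sup>+ r. ennreal (pos_powr r (a - 1) * pos_powr (1 - r) (b - 1)) \<partial>lborel) = ennreal (Beta a b)"
proof -
  have "(\<integral>\<^sup>+ r. ennreal (pos_powr r (a - 1) * pos_powr (1 - r) (b - 1)) \<partial>lborel)
      = (\<integral>\<^sup>+ r. ennreal (indicator {0..1} r * (r powr (a - 1) * (1 - r) powr (b - 1))) \<partial>lborel)"
    by (intro nn_integral_cong) (auto simp: indicator_def pos_powr_def max_def)
  also have "\<dots> = ennreal (Beta a b)"
    by (intro nn_integral_has_integral_lebesgue has_integral_Beta_real assms) auto
  finally show ?thesis .
qed

text \<open>A convolution of two one-sided powers: for \<open>t < u\<close> the substitution
  \<open>s = t + (u - t) * r\<close> reduces it to Euler's Beta integral, and the powers of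
  \<open>u - t\<close>, including the Jacobian, add up to
  \<open>(a - b - 1) + b + 1 = a\<close>.\<close>

lemma nn_integral_pos_powr_mixture:
  assumes "0 \<le> b" "b < a"
  shows "(\<integral>\<^sup>+ s. ennreal (pos_powr (s - t) (a - b - 1)) * ennreal (pos_powr (u - s) b) \<partial>lborel)
      = ennreal (Beta (a - b) (b + 1)) * ennreal (pos_powr (u - t) a)"
proof (cases "t < u")
  case False
  have "(\<integral>\<^sup>+ s. ennreal (pos_powr (s - t) (a - b - 1)) * ennreal (pos_powr (u - s) b) \<partial>lborel)
      = (\<integral>\<^sup>+ s. 0 \<partial>(lborel :: real measure))"
    using False by (intro nn_integral_cong) (auto simp: pos_powr_def max_def)
  then show ?thesis using False by (simp add: pos_powr_def)
next
  case True
  define d where "d = u - t"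
  have d: "0 < d" using True by (simp add: d_def)
  note scale = pos_powr_scale[OF less_imp_le[OF d]]
  have int: "(\<lambda>s. ennreal (pos_powr (s - t) (a - b - 1)) * ennreal (pos_powr (u - s) b)) \<in> borel_measurable borel"
    unfolding pos_powr_def by measurable
  have "(\<integral>\<^sup>+ s. ennreal (pos_powr (s - t) (a - b - 1)) * ennreal (pos_powr (u - s) b) \<partial>lborel)
     = ennreal d * (\<integral>\<^sup>+ r. ennreal (pos_powr (d * r) (a - b - 1)) * ennreal (pos_powr (d * (1 - r)) b) \<partial>lborel)"
    using d by (subst nn_integral_real_affine[OF int, of d t]) (simp_all add: d_def algebra_simps)
  also have "\<dots> = ennreal d * (\<integral>\<^sup>+ r. ennreal (d powr (a - b - 1) * d powr b) *
      ennreal (pos_powr r ((a - b) - 1) * pos_powr (1 - r) ((b + 1) - 1)) \<partial>lborel)"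
    by (simp add: scale flip: ennreal_mult) (simp add: pos_powr_def mult_ac flip: ennreal_mult)
  also have "\<dots> = ennreal d * (ennreal (d powr (a - b - 1) * d powr b) * ennreal (Beta (a - b) (b + 1)))"
    using assms by (subst nn_integral_cmult) (simp_all only: nn_integral_Beta, simp_all add: pos_powr_def)
  also have "\<dots> = ennreal (d * (d powr (a - b - 1) * d powr b)) * ennreal (Beta (a - b) (b + 1))"
    using d by (simp add: ennreal_mult' mult.assoc)
  also have "d * (d powr (a - b - 1) * d powr b) = pos_powr (u - t) a"
    using d powr_add[of d 1 "a - 1"] by (simp add: pos_powr_def d_def flip: powr_add)
  finally show ?thesis by (simp add: mult.commute)
qed

text \<open>The substitution \<open>s = u - r / l\<close> extracts \<open>exp (l * u)\<close> and
  leaves Euler's Gamma integral in r; the power of l collects the Jacobian and the factor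
  \<open>(1 / l) powr b\<close>.\<close>

lemma nn_integral_exp_mixture:
  assumes "0 \<le> b" "0 < l"
  shows "(\<integral>\<^sup>+ s. ennreal (exp (l * s)) * ennreal (pos_powr (u - s) b) \<partial>lborel)
      = ennreal (Gamma (b + 1) / l powr (b + 1)) * ennreal (exp (l * u))"
proof -
  have int: "(\<lambda>s. ennreal (exp (l * s)) * ennreal (pos_powr (u - s) b)) \<in> borel_measurable borel"
    unfolding pos_powr_def by measurable
  have eq: "ennreal (exp (l * (u + - (1 / l) * r))) * ennreal (pos_powr (u - (u + - (1 / l) * r)) b)
      = ennreal ((1 / l) powr b * exp (l * u)) * ennreal (indicator {0..} r * r powr (b + 1 - 1) / exp r)" for r
  proof -
    have "pos_powr (r / l) b = (1 / l) powr b * (indicator {0..} r * r powr b)"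
      using assms by (auto simp: pos_powr_def max_def powr_divide indicator_def divide_less_0_iff zero_le_divide_iff)
    then show ?thesis using assms
      by (simp add: exp_diff right_diff_distrib pos_powr_def mult_ac flip: ennreal_mult)
  qed
  have "(\<integral>\<^sup>+ s. ennreal (exp (l * s)) * ennreal (pos_powr (u - s) b) \<partial>lborel)
     = ennreal (1 / l) * (\<integral>\<^sup>+ r. ennreal ((1 / l) powr b * exp (l * u)) *
         ennreal (indicator {0..} r * r powr (b + 1 - 1) / exp r) \<partial>lborel)"
    using assms by (subst nn_integral_real_affine[OF int, of "- (1 / l)" u]) (simp_all only: eq, simp_all)
  also have "\<dots> = ennreal (1 / l) * (ennreal ((1 / l) powr b * exp (l * u)) * ennreal (Gamma (b + 1)))"
    using assms by (subst nn_integral_cmult) (simp_all only: Gamma_conv_nn_integral_real, simp_all)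
  also have "\<dots> = ennreal (((1 / l) * (1 / l) powr b * Gamma (b + 1)) * exp (l * u))"
    using assms Gamma_real_pos[of "b + 1"] by (simp add: mult_ac flip: ennreal_mult)
  also have "(1 / l) * (1 / l) powr b * Gamma (b + 1) = Gamma (b + 1) / l powr (b + 1)"
    using assms by (simp add: powr_divide powr_add)
  finally show ?thesis using Gamma_real_pos[of "b + 1"] assms by (simp flip: ennreal_mult'')
qed

lemma stoch_dom_g_fun_higher:
  assumes dom: "stoch_dom \<gamma> M X N Y" and "1 \<le> \<gamma>" "\<gamma> \<le> \<alpha> + 1" "t \<in> T_set \<alpha>"
    and X: "X \<in> borel_measurable M" and Y: "Y \<in> borel_measurable N"
  shows "(\<integral>\<^sup>+ \<omega>. ennreal (g_fun \<alpha> t (X \<omega>)) \<partial>M) \<le> (\<integral>\<^sup>+ \<omega>. ennreal (g_fun \<alpha> t (Y \<omega>)) \<partial>N)"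
proof -
  define \<beta> where "\<beta> = \<gamma> - 1"
  have \<gamma>: "\<gamma> = \<beta> + 1" using assms(2) by (simp add: \<beta>_def diff_add_cancel_ennreal)
  have "\<beta> \<le> \<alpha>" using assms(3) by (simp add: \<gamma>)
  show ?thesis
  proof (cases "\<beta> = \<alpha>")
    case True
    then show ?thesis using stoch_dom_g_fun dom assms(4) \<gamma> by blast
  next
    case False
    with \<open>\<beta> \<le> \<alpha>\<close> have "\<beta> < \<alpha>" by simp
    \<comment> \<open>A strictly smaller order is finite, so the generators being mixed are always
      powers; only the target may be exponential.\<close>
    then obtain b where b: "0 \<le> b" "\<beta> = ennreal b" by (cases \<beta>) auto
    note dom' = dom[unfolded \<gamma> b(2)]
    show ?thesis
    proof (cases "\<alpha> = \<infinity>")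
      case True
      then have t: "0 < t" using assms(4) by (simp add: T_set_def)
      have g: "g_fun \<alpha> t u = exp (1 / t * u)" for u by (simp add: True g_fun_def)
      show ?thesis unfolding g
        by (rule stoch_dom_mixture[OF dom' b(1) X Y, of "\<lambda>s. ennreal (exp (1 / t * s))" _
            "ennreal (Gamma (b + 1) / (1 / t) powr (b + 1))"])
          (use t b Gamma_real_pos[of "b + 1"] nn_integral_exp_mixture[OF b(1), of "1 / t"] in auto)
    next
      case False
      then obtain a where a: "0 \<le> a" "\<alpha> = ennreal a" by (cases \<alpha>) auto
      have ab: "b < a" using \<open>\<beta> < \<alpha>\<close> a b by (simp add: ennreal_less_iff)
      have g: "g_fun \<alpha> t u = pos_powr (u - t) a" for u using a by (simp add: g_fun_finite)
      have B: "0 < Beta (a - b) (b + 1)"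
        using ab b by (simp add: Beta_def Gamma_real_pos)
      show ?thesis unfolding g
        by (rule stoch_dom_mixture[OF dom' b(1) X Y, of "\<lambda>s. ennreal (pos_powr (s - t) (a - b - 1))" _
            "ennreal (Beta (a - b) (b + 1))"])
          (use B b ab nn_integral_pos_powr_mixture[OF b(1) ab] in \<open>auto simp: pos_powr_def\<close>)
    qed
  qed
qed

lemma nn_integral_g_fun_zero:
  assumes [measurable]: "X \<in> borel_measurable M"
  shows "(\<integral>\<^sup>+ \<omega>. ennreal (g_fun 0 t (X \<omega>)) \<partial>M) = emeasure M {\<omega> \<in> space M. t < X \<omega>}"
proof -
  have "(\<integral>\<^sup>+ \<omega>. ennreal (g_fun 0 t (X \<omega>)) \<partial>M)
      = (\<integral>\<^sup>+ \<omega>. indicator {\<omega> \<in> space M. t < X \<omega>} \<omega> \<partial>M)"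
    by (intro nn_integral_cong) (auto simp: g_fun_def indicator_def)
  then show ?thesis by simp
qed

lemma Q_bound_mono_g_fun:
  assumes X [measurable]: "X \<in> borel_measurable M" and Y [measurable]: "Y \<in> borel_measurable N"
    and g: "\<And>t. t \<in> T_set \<alpha> \<Longrightarrow>
      (\<integral>\<^sup>+ \<omega>. ennreal (g_fun \<alpha> t (X \<omega>)) \<partial>M) \<le> (\<integral>\<^sup>+ \<omega>. ennreal (g_fun \<alpha> t (Y \<omega>)) \<partial>N)"
  shows "Q_bound M \<alpha> X p \<le> Q_bound N \<alpha> Y p"
proof (cases "\<alpha> = 0")
  case True
  show ?thesis
  proof (rule Q_bound_geI)
    fix x assume *: "P_bound N \<alpha> Y x < ennreal p"
    show "Q_bound M \<alpha> X p \<le> ereal x"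
      unfolding Q_bound_le_iff
    proof (intro allI impI)
      \<comment> \<open>Generators of order zero measure the open tail, \<open>P_bound\<close> the
        closed one; the gap between x and y absorbs the difference.\<close>
      fix y assume "x < y"
      have "P_bound M \<alpha> X y \<le> emeasure M {\<omega> \<in> space M. x < X \<omega>}"
        unfolding True P_bound_zero[OF X] using \<open>x < y\<close> by (intro emeasure_mono) auto
      also have "\<dots> \<le> emeasure N {\<omega> \<in> space N. x < Y \<omega>}"
        using g[of x] by (simp add: nn_integral_g_fun_zero[OF X] nn_integral_g_fun_zero[OF Y] True T_set_def)
      also have "\<dots> \<le> P_bound N \<alpha> Y x"
        unfolding True P_bound_zero[OF Y] by (intro emeasure_mono) auto
      finally show "P_bound M \<alpha> X y < ennreal p" using * by simp
    qed
  qed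
next
  case False
  show ?thesis
  proof (rule Q_bound_mono_P)
    fix x
    \<comment> \<open>At each scale the integrand is a nonnegative multiple of a single generator,
      with parameter \<open>1 / l\<close> for infinite \<alpha> and \<open>x - a / l\<close>
      otherwise. The bounds can thus be compared scale by scale.\<close>
    have "\<exists>t\<in>T_set \<alpha>. \<exists>c\<ge>0. \<forall>u. h_fun \<alpha> (l * (u - x)) = c * g_fun \<alpha> t u" if "0 < l" for l
    proof (cases "\<alpha> = \<infinity>")
      case True
      then show ?thesis using that
        by (intro bexI[of _ "1 / l"] exI[of _ "exp (- l * x)"])
          (auto simp: h_fun_def g_fun_def T_set_def right_diff_distrib mult.commute simp flip: exp_add)
    next
      case inf: False
      with False obtain a where a: "0 < a" "\<alpha> = ennreal a" using ennreal_pos_finiteE by metis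
      show ?thesis
      proof (intro bexI[of _ "x - a / l"] exI[of _ "(l / a) powr a"] conjI allI)
        fix u
        show "h_fun \<alpha> (l * (u - x)) = (l / a) powr a * g_fun \<alpha> (x - a / l) u"
          unfolding a(2) using a that by (simp add: h_fun_finite_shift g_fun_finite)
      qed (use inf in \<open>auto simp: T_set_def\<close>)
    qed
    then show "P_bound M \<alpha> X x \<le> P_bound N \<alpha> Y x"
      unfolding P_bound_def
    proof (intro INF_superset_mono order_refl)
      fix l :: real assume *: "\<And>l. 0 < l \<Longrightarrow> \<exists>t\<in>T_set \<alpha>. \<exists>c\<ge>0. \<forall>u. h_fun \<alpha> (l * (u - x)) = c * g_fun \<alpha> t u"
        and "l \<in> {0<..}"
      then obtain t c where tc: "t \<in> T_set \<alpha>" "0 \<le> c" "\<And>u. h_fun \<alpha> (l * (u - x)) = c * g_fun \<alpha> t u"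
        by (meson greaterThan_iff)
      show "(\<integral>\<^sup>+ \<omega>. ennreal (h_fun \<alpha> (l * (X \<omega> - x))) \<partial>M)
          \<le> (\<integral>\<^sup>+ \<omega>. ennreal (h_fun \<alpha> (l * (Y \<omega> - x))) \<partial>N)"
        unfolding tc(3) using g[OF tc(1)] tc(2)
        by (simp add: ennreal_mult' nn_integral_cmult mult_left_mono)
    qed
  qed
qed

lemma Q_bound_mono_stoch_dom:
  assumes "stoch_dom \<gamma> M X N Y" "1 \<le> \<gamma>" "\<gamma> \<le> \<alpha> + 1"
    and "X \<in> borel_measurable M" "Y \<in> borel_measurable N"
  shows "Q_bound M \<alpha> X p \<le> Q_bound N \<alpha> Y p"
  using Q_bound_mono_g_fun[OF assms(4,5)] stoch_dom_g_fun_higher[OF assms(1-3) _ assms(4,5)] by blast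

section \<open>Concavity in the level\<close>

lemma rv_class_measurable: "X \<in> rv_class M \<alpha> \<Longrightarrow> X \<in> borel_measurable M"
  by (simp add: rv_class_def)

text \<open>The tail probability is \<open>P_bound\<close> at index 0, the smallest index; a lower
  bound on it therefore works for every \<alpha>.\<close>

lemma Q_bound_ge_prob:
  assumes "X \<in> borel_measurable M" "ennreal p \<le> emeasure M {\<omega> \<in> space M. x \<le> X \<omega>}"
  shows "ereal x \<le> Q_bound M \<alpha> X p"
proof (rule Q_bound_geI)
  fix y assume *: "P_bound M \<alpha> X y < ennreal p"
  show "ereal x \<le> ereal y"
  proof (rule ccontr)
    assume "\<not> ereal x \<le> ereal y"
    then have "P_bound M 0 X x \<le> P_bound M 0 X y" by (intro P_bound_antimono) simp
    also have "\<dots> \<le> P_bound M \<alpha> X y" by (intro P_bound_mono_index) simp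
    finally show False using * assms by (simp add: P_bound_zero)
  qed
qed

lemma Q_bound_not_MInf:
  assumes "prob_space M" and [measurable]: "X \<in> borel_measurable M" and "p < 1"
  shows "Q_bound M \<alpha> X p \<noteq> - \<infinity>"
proof -
  interpret prob_space M by fact
  define A where "A n = {\<omega> \<in> space M. - real n \<le> X \<omega>}" for n
  have "range A \<subseteq> sets M" by (auto simp: A_def)
  moreover have "incseq A" by (force simp: A_def incseq_def)
  ultimately have "(\<lambda>n. emeasure M (A n)) \<longlonglongrightarrow> emeasure M (\<Union>n. A n)" by (rule Lim_emeasure_incseq)
  moreover have "(\<Union>n. A n) = space M"
    by (auto simp: A_def) (meson real_arch_simple minus_le_iff)
  ultimately have "(\<lambda>n. emeasure M (A n)) \<longlonglongrightarrow> 1" by (simp add: emeasure_space_1)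
  moreover have "ennreal p < 1" using assms(3) by (simp add: ennreal_less_one_iff)
  ultimately have "\<forall>\<^sub>F n in sequentially. ennreal p < emeasure M (A n)" by (rule order_tendstoD)
  then obtain n where "ennreal p < emeasure M (A n)" by (auto simp: eventually_sequentially)
  then have "ereal (- real n) \<le> Q_bound M \<alpha> X p" by (intro Q_bound_ge_prob) (auto simp: A_def)
  then show ?thesis by auto
qed

lemma Q_bound_zero_not_PInf:
  assumes "prob_space M" and [measurable]: "X \<in> borel_measurable M" and "0 < p"
  shows "Q_bound M 0 X p \<noteq> \<infinity>"
proof -
  interpret prob_space M by fact
  define A where "A n = {\<omega> \<in> space M. real n \<le> X \<omega>}" for n
  have "range A \<subseteq> sets M" by (auto simp: A_def)
  moreover have "decseq A" by (force simp: A_def decseq_def)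
  ultimately have "(\<lambda>n. emeasure M (A n)) \<longlonglongrightarrow> emeasure M (\<Inter>n. A n)"
    by (rule Lim_emeasure_decseq) auto
  moreover have "(\<Inter>n. A n) = {}"
    by (auto simp: A_def) (meson reals_Archimedean2 not_less)
  ultimately have "(\<lambda>n. emeasure M (A n)) \<longlonglongrightarrow> 0" by simp
  moreover have "0 < ennreal p" using assms(3) by simp
  ultimately have "\<forall>\<^sub>F n in sequentially. emeasure M (A n) < ennreal p" by (rule order_tendstoD)
  then obtain n where "emeasure M (A n) < ennreal p" by (auto simp: eventually_sequentially)
  then have "Q_bound M 0 X p \<le> ereal (real n)" by (intro Q_bound_le) (simp add: P_bound_zero A_def)
  then show ?thesis by auto
qed

text \<open>The change of variable in the level \<open>p\<close> that turns \<open>Q_bound\<close> into an infimum of affine functions.\<close>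

definition level_scale :: "ennreal \<Rightarrow> real \<Rightarrow> real" where
  "level_scale \<alpha> q = (if \<alpha> = \<infinity> then ln (1 / q) else q powr (- 1 / enn2real \<alpha>))"

lemma level_scale_strict_antimono:
  assumes "0 < \<alpha>" "0 < p" "p < q"
  shows "level_scale \<alpha> q < level_scale \<alpha> p"
proof (cases "\<alpha> = \<infinity>")
  case True
  then show ?thesis using assms by (simp add: level_scale_def ln_div)
next
  case False
  then obtain a where "0 < a" "enn2real \<alpha> = a" using ennreal_pos_finiteE assms(1) by (metis less_irrefl)
  then show ?thesis using False assms
    by (simp add: level_scale_def) (simp add: powr_minus powr_less_mono2 flip: minus_divide_left)
qed

lemma continuous_on_level_scale: "continuous_on {0<..<1} (level_scale \<alpha>)"
  unfolding level_scale_def by (cases "\<alpha> = \<infinity>") (auto intro!: continuous_intros)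

lemma level_scale_image:
  assumes "0 < \<alpha>"
  shows "level_scale \<alpha> ` {0<..<1} = (if \<alpha> = \<infinity> then {0<..} else {1<..})"
proof (cases "\<alpha> = \<infinity>")
  case True
  have "y \<in> level_scale \<alpha> ` {0<..<1}" if "0 < y" for y
    using that True by (intro image_eqI[of _ _ "exp (- y)"]) (auto simp: level_scale_def ln_div)
  then show ?thesis using True by (auto simp: level_scale_def ln_div)
next
  case False
  then obtain a where a: "0 < a" "enn2real \<alpha> = a" using ennreal_pos_finiteE assms(1) by (metis less_irrefl)
  have "1 < q powr (- 1 / a)" if "0 < q" "q < 1" for q
    using that a powr_less_mono2_neg[of "- 1 / a" q 1] by simp
  moreover have "y \<in> level_scale \<alpha> ` {0<..<1}" if "1 < y" for y
    using that a False powr_less_mono2_neg[of "- a" 1 y]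
    by (intro image_eqI[of _ _ "y powr (- a)"]) (auto simp: level_scale_def powr_powr)
  ultimately show ?thesis using False a by (auto simp: level_scale_def)
qed

lemma open_level_scale_image: "0 < \<alpha> \<Longrightarrow> open (level_scale \<alpha> ` {0<..<1})"
  by (simp add: level_scale_image)

lemma convex_level_scale_image: "0 < \<alpha> \<Longrightarrow> convex (level_scale \<alpha> ` {0<..<1})"
  by (simp add: level_scale_image)

text \<open>With \<open>s = a / l\<close> and \<open>t = x - s\<close> the expectation is
  \<open>E t / s powr a\<close>. Extracting roots of order a turns the bound by q into
  \<open>d t * q powr (- 1 / a) < s\<close>, that is, an affine function of the level scale lying
  below x.\<close>

lemma P_bound_affine_finite:
  assumes a: "0 < a" and X: "X \<in> rv_class M (ennreal a)"
  obtains I :: "real set" and c d where "I \<noteq> {}"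
    "\<And>q x. 0 < q \<Longrightarrow> P_bound M (ennreal a) X x < ennreal q \<longleftrightarrow>
       (\<exists>t\<in>I. c t + d t * level_scale (ennreal a) q < x)"
proof -
  have [measurable]: "X \<in> borel_measurable M" using X by (rule rv_class_measurable)
  define E where "E t = (\<integral>\<^sup>+ \<omega>. ennreal (pos_powr (X \<omega> - t) a) \<partial>M)" for t
  \<comment> \<open>\<open>enn2real\<close> sends an infinite moment to 0, which would create
    spurious members of the family; hence the index set keeps only t with finite
    \<open>E t\<close>.\<close>
  define d where "d t = enn2real (E t) powr (1 / a)" for t
  have "E 0 < \<infinity>" using X a by (simp add: rv_class_def E_def)
  have int: "(\<integral>\<^sup>+ \<omega>. ennreal (h_fun (ennreal a) (l * (X \<omega> - x))) \<partial>M)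
      = ennreal ((l / a) powr a) * E (x - a / l)" if "0 < l" for l x
    unfolding E_def using a that
    by (simp add: h_fun_finite_shift ennreal_mult' nn_integral_cmult)
  have key: "ennreal ((l / a) powr a) * E (x - a / l) < ennreal q \<longleftrightarrow>
      E (x - a / l) < \<infinity> \<and> (x - a / l) + d (x - a / l) * level_scale (ennreal a) q < x"
    if "0 < l" "0 < q" for l x q
  proof (cases "E (x - a / l)")
    case (real e)
    define s where "s = a / l"
    have s: "0 < s" "l / a = 1 / s" using that a by (auto simp: s_def)
    have "(1 / s) powr a * e < q \<longleftrightarrow> e < q * s powr a"
      using s by (simp add: powr_divide field_simps)
    also have "\<dots> \<longleftrightarrow> e powr (1 / a) < (q * s powr a) powr (1 / a)"
    proof
      assume "e powr (1 / a) < (q * s powr a) powr (1 / a)"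
      then show "e < q * s powr a"
        using real that a powr_mono2[of "1 / a" "q * s powr a" e] by (cases "e < q * s powr a") auto
    qed (use real a in \<open>auto intro!: powr_less_mono2\<close>)
    also have "(q * s powr a) powr (1 / a) = q powr (1 / a) * s"
      using s that a by (simp add: powr_mult powr_powr)
    also have "e powr (1 / a) < q powr (1 / a) * s \<longleftrightarrow> e powr (1 / a) * q powr (- 1 / a) < s"
      using that by (simp add: powr_minus field_simps)
    finally show ?thesis
      using s real that a
      by (simp add: s_def[symmetric] d_def level_scale_def ennreal_less_iff flip: ennreal_mult)
  qed (use that a in \<open>simp add: ennreal_mult_top\<close>)
  show ?thesis
  proof (rule that[of "{t. E t < \<infinity>}" "\<lambda>t. t" d])
    show "{t. E t < \<infinity>} \<noteq> {}" using \<open>E 0 < \<infinity>\<close> by auto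
    fix q x :: real assume "0 < q"
    have "P_bound M (ennreal a) X x < ennreal q \<longleftrightarrow>
      (\<exists>l>0. E (x - a / l) < \<infinity> \<and> (x - a / l) + d (x - a / l) * level_scale (ennreal a) q < x)"
      unfolding P_bound_less_iff using int key \<open>0 < q\<close> by (metis (no_types, lifting))
    also have "\<dots> \<longleftrightarrow> (\<exists>t\<in>{t. E t < \<infinity>}. t + d t * level_scale (ennreal a) q < x)"
    proof safe
      fix t assume t: "E t < \<infinity>" "t + d t * level_scale (ennreal a) q < x"
      \<comment> \<open>Conversely, the slope term is nonnegative, so t lies below x and comes from
        the scale \<open>a / (x - t)\<close>.\<close>
      have "0 \<le> d t * level_scale (ennreal a) q" by (simp add: d_def level_scale_def)
      with t(2) have "t < x" by linarith
      then show "\<exists>l>0. E (x - a / l) < \<infinity> \<and> (x - a / l) + d (x - a / l) * level_scale (ennreal a) q < x"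
        using t a by (intro exI[of _ "a / (x - t)"]) simp
    qed blast
    finally show "P_bound M (ennreal a) X x < ennreal q \<longleftrightarrow>
      (\<exists>t\<in>{t. E t < \<infinity>}. t + d t * level_scale (ennreal a) q < x)" .
  qed
qed

lemma P_bound_affine_infinity:
  assumes "prob_space M" and X: "X \<in> rv_class M \<infinity>"
  obtains I :: "real set" and c d where "I \<noteq> {}"
    "\<And>q x. 0 < q \<Longrightarrow> P_bound M \<infinity> X x < ennreal q \<longleftrightarrow>
       (\<exists>t\<in>I. c t + d t * level_scale \<infinity> q < x)"
proof -
  interpret prob_space M by fact
  have [measurable]: "X \<in> borel_measurable M" using X by (rule rv_class_measurable)
  define E where "E l = (\<integral>\<^sup>+ \<omega>. ennreal (exp (l * X \<omega>)) \<partial>M)" for l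
  define c where "c l = ln (enn2real (E l)) / l" for l
  \<comment> \<open>Positivity of the moment is what permits taking logarithms below.\<close>
  have E0: "E l \<noteq> 0" for l
  proof
    assume "E l = 0"
    then have "AE \<omega> in M. ennreal (exp (l * X \<omega>)) = 0" unfolding E_def by (subst (asm) nn_integral_0_iff_AE) auto
    then have "AE \<omega> in M. False" by eventually_elim simp
    then show False using AE_False by simp
  qed
  have I: "exp_moment_set M X = {l. 0 < l \<and> E l < \<infinity>}"
    by (simp add: exp_moment_set_def E_def)
  have int: "(\<integral>\<^sup>+ \<omega>. ennreal (h_fun \<infinity> (l * (X \<omega> - x))) \<partial>M) = ennreal (exp (- l * x)) * E l" for l x
  proof -
    have "ennreal (h_fun \<infinity> (l * (X \<omega> - x))) = ennreal (exp (- l * x)) * ennreal (exp (l * X \<omega>))" for \<omega>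
      by (simp add: h_fun_def right_diff_distrib flip: ennreal_mult exp_add)
    then show ?thesis by (simp add: nn_integral_cmult E_def)
  qed
  have key: "ennreal (exp (- l * x)) * E l < ennreal q \<longleftrightarrow>
      E l < \<infinity> \<and> c l + 1 / l * level_scale \<infinity> q < x" if "0 < l" "0 < q" for l x q
  proof (cases "E l")
    case (real e)
    then have "0 < e" using E0[of l] by (auto simp: order_less_le)
    have "exp (- l * x) * e < q \<longleftrightarrow> ln (exp (- l * x) * e) < ln q"
      using \<open>0 < e\<close> that by (subst ln_less_cancel_iff) auto
    also have "\<dots> \<longleftrightarrow> ln e / l + 1 / l * ln (1 / q) < x"
      using \<open>0 < e\<close> that by (simp add: ln_mult ln_div field_simps)
    finally show ?thesis
      using real that by (simp add: c_def level_scale_def ennreal_less_iff flip: ennreal_mult)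
  qed (use that in \<open>simp add: ennreal_mult_top\<close>)
  show ?thesis
  proof (rule that[of "exp_moment_set M X" c "\<lambda>l. 1 / l"])
    show "exp_moment_set M X \<noteq> {}" using X by (simp add: rv_class_def)
    fix q x :: real assume "0 < q"
    show "P_bound M \<infinity> X x < ennreal q \<longleftrightarrow>
      (\<exists>t\<in>exp_moment_set M X. c t + 1 / t * level_scale \<infinity> q < x)"
      unfolding P_bound_less_iff I using int key \<open>0 < q\<close> by (metis (no_types, lifting) mem_Collect_eq)
  qed
qed

text \<open>A common form for finite and infinite \<alpha>: finiteness and concavity below use only
  that such an affine family exists.\<close>

lemma P_bound_affine:
  assumes "prob_space M" "0 < \<alpha>" and X: "X \<in> rv_class M \<alpha>"
  obtains I :: "real set" and c d where "I \<noteq> {}"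
    "\<And>q x. 0 < q \<Longrightarrow> P_bound M \<alpha> X x < ennreal q \<longleftrightarrow>
       (\<exists>t\<in>I. c t + d t * level_scale \<alpha> q < x)"
proof (cases "\<alpha> = \<infinity>")
  case True
  then show ?thesis using P_bound_affine_infinity[OF assms(1)] X that by blast
next
  case False
  then obtain a where "0 < a" "\<alpha> = ennreal a" using ennreal_pos_finiteE assms(2) by (metis less_irrefl)
  then show ?thesis using P_bound_affine_finite X that by metis
qed

lemma Q_bound_finite:
  assumes "prob_space M" "0 < p" "p < 1" "X \<in> rv_class M \<alpha>"
  shows "\<bar>Q_bound M \<alpha> X p\<bar> \<noteq> \<infinity>"
proof -
  have X: "X \<in> borel_measurable M" using assms(4) by (rule rv_class_measurable)
  have "Q_bound M \<alpha> X p \<noteq> \<infinity>"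
  proof (cases "\<alpha> = 0")
    case True
    then show ?thesis using Q_bound_zero_not_PInf[OF assms(1) X assms(2)] by simp
  next
    case False
    then have "0 < \<alpha>" by (simp add: order_less_le)
    from P_bound_affine[OF assms(1) this assms(4)] obtain I :: "real set" and c d where I: "I \<noteq> {}"
      "\<And>q x. 0 < q \<Longrightarrow> P_bound M \<alpha> X x < ennreal q \<longleftrightarrow> (\<exists>t\<in>I. c t + d t * level_scale \<alpha> q < x)"
      by blast
    then obtain t where "t \<in> I" by blast
    then have "P_bound M \<alpha> X (c t + d t * level_scale \<alpha> p + 1) < ennreal p"
      using I(2) assms(2) by force
    then have "Q_bound M \<alpha> X p \<le> ereal (c t + d t * level_scale \<alpha> p + 1)" by (rule Q_bound_le)
    then show ?thesis by auto
  qed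
  moreover have "Q_bound M \<alpha> X p \<noteq> - \<infinity>" using Q_bound_not_MInf assms X by blast
  ultimately show ?thesis by (cases "Q_bound M \<alpha> X p") auto
qed

text \<open>A pointwise infimum of affine functions is concave. Finiteness of \<open>Q_bound\<close>
  bounds the family below at each level, so that the real-valued \<open>INF\<close> is the true
  infimum.\<close>

lemma Q_bound_concave:
  assumes "prob_space M" "0 < \<alpha>" "X \<in> rv_class M \<alpha>"
  obtains f where "concave_on (level_scale \<alpha> ` {0<..<1}) f"
    "\<And>q. 0 < q \<Longrightarrow> q < 1 \<Longrightarrow> Q_bound M \<alpha> X q = ereal (f (level_scale \<alpha> q))"
proof -
  from P_bound_affine[OF assms] obtain I :: "real set" and c d where I: "I \<noteq> {}"
    "\<And>q x. 0 < q \<Longrightarrow> P_bound M \<alpha> X x < ennreal q \<longleftrightarrow> (\<exists>t\<in>I. c t + d t * level_scale \<alpha> q < x)"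
    by blast
  define f where "f r = (INF t\<in>I. c t + d t * r)" for r
  have *: "Q_bound M \<alpha> X q = ereal (f (level_scale \<alpha> q)) \<and> bdd_below ((\<lambda>t. c t + d t * level_scale \<alpha> q) ` I)"
    if q: "0 < q" "q < 1" for q
  proof -
    let ?r = "level_scale \<alpha> q"
    obtain m where m: "Q_bound M \<alpha> X q = ereal m"
      using Q_bound_finite[OF assms(1) q assms(3)] by (cases "Q_bound M \<alpha> X q") auto
    have lower: "m \<le> c t + d t * ?r" if "t \<in> I" for t
    proof (rule field_le_epsilon)
      fix e :: real assume "0 < e"
      with that have "P_bound M \<alpha> X (c t + d t * ?r + e) < ennreal q" using I(2) q by force
      then show "m \<le> c t + d t * ?r + e" using Q_bound_le m by fastforce
    qed
    have bdd: "bdd_below ((\<lambda>t. c t + d t * ?r) ` I)" using lower by (rule bdd_belowI2)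
    have "f ?r \<le> m"
    proof (rule field_le_epsilon)
      fix e :: real assume "0 < e"
      then have "P_bound M \<alpha> X (m + e) < ennreal q" using m by (intro Q_bound_lessD) simp
      then obtain t where "t \<in> I" "c t + d t * ?r < m + e" using I(2) q by auto
      then show "f ?r \<le> m + e" using cINF_lower[OF bdd] unfolding f_def by fastforce
    qed
    moreover have "m \<le> f ?r" unfolding f_def using I(1) lower by (intro cINF_greatest)
    ultimately show ?thesis using m bdd by simp
  qed
  have "concave_on (level_scale \<alpha> ` {0<..<1}) f"
    unfolding concave_on_iff
  proof (intro conjI ballI allI impI)
    show "convex (level_scale \<alpha> ` {0<..<1})" by (rule convex_level_scale_image) fact
    fix x y u v assume x: "x \<in> level_scale \<alpha> ` {0<..<1}" and y: "y \<in> level_scale \<alpha> ` {0<..<1}"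
      and uv: "0 \<le> u" "0 \<le> v" "u + v = (1::real)"
    have "u * f x + v * f y \<le> f (u * x + v * y)"
      unfolding f_def[of "u * x + v * y"]
    proof (rule cINF_greatest[OF I(1)])
      fix t assume t: "t \<in> I"
      have "f x \<le> c t + d t * x" "f y \<le> c t + d t * y"
        unfolding f_def using x y * t by (auto intro!: cINF_lower)
      then have "u * f x + v * f y \<le> u * (c t + d t * x) + v * (c t + d t * y)"
        using uv by (intro add_mono mult_left_mono)
      also have "\<dots> = (u + v) * c t + d t * (u * x + v * y)" by (simp add: algebra_simps)
      finally show "u * f x + v * f y \<le> c t + d t * (u * x + v * y)" using uv by simp
    qed
    then show "u * f x + v * f y \<le> f (u *\<^sub>R x + v *\<^sub>R y)" by simp
  qed
  then show ?thesis using that * by blast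
qed

lemma concave_in_Q_bound:
  assumes "prob_space M" "0 < \<alpha>" "X \<in> rv_class M \<alpha>"
  shows "concave_in {0<..<1} (level_scale \<alpha>) (\<lambda>q. Q_bound M \<alpha> X q)"
  using Q_bound_concave[OF assms] unfolding concave_in_def by (metis greaterThanLessThan_iff)

text \<open>The level scale maps the open interval of levels onto an open set, and a concave
  function is continuous on an open set.\<close>

lemma continuous_on_Q_bound:
  assumes "prob_space M" "0 < \<alpha>" "X \<in> rv_class M \<alpha>"
  shows "continuous_on {0<..<1} (\<lambda>q. Q_bound M \<alpha> X q)"
proof -
  obtain f where f: "concave_on (level_scale \<alpha> ` {0<..<1}) f"
    "\<And>q. 0 < q \<Longrightarrow> q < 1 \<Longrightarrow> Q_bound M \<alpha> X q = ereal (f (level_scale \<alpha> q))"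
    using Q_bound_concave[OF assms] by blast
  have "continuous_on (level_scale \<alpha> ` {0<..<1}) (\<lambda>x. - f x)"
    by (rule convex_on_continuous[OF open_level_scale_image[OF assms(2)] f(1)[unfolded concave_on_def]])
  from continuous_on_minus[OF this] have "continuous_on (level_scale \<alpha> ` {0<..<1}) f" by simp
  then have "continuous_on {0<..<1} (\<lambda>q. f (level_scale \<alpha> q))"
    by (rule continuous_on_compose2[OF _ continuous_on_level_scale]) auto
  then have "continuous_on {0<..<1} (\<lambda>q. ereal (f (level_scale \<alpha> q)))"
    by (rule continuous_on_ereal)
  then show ?thesis by (rule continuous_on_eq) (simp add: f(2))
qed

text \<open>Concavity pulled back to levels. The level scale is decreasing, so s is the relative
  position of q's scale measured from r towards p.\<close>

lemma Q_bound_three_levels: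
  assumes "prob_space M" "0 < \<alpha>" "X \<in> rv_class M \<alpha>" "0 < p" "p < q" "q < r" "r < 1"
  obtains s where "0 < s" "s < 1"
    "ereal (1 - s) * Q_bound M \<alpha> X r + ereal s * Q_bound M \<alpha> X p \<le> Q_bound M \<alpha> X q"
proof -
  obtain f where f: "concave_on (level_scale \<alpha> ` {0<..<1}) f"
    "\<And>q. 0 < q \<Longrightarrow> q < 1 \<Longrightarrow> Q_bound M \<alpha> X q = ereal (f (level_scale \<alpha> q))"
    using Q_bound_concave[OF assms(1-3)] by blast
  let ?l = "level_scale \<alpha>"
  have l: "?l r < ?l q" "?l q < ?l p"
    using assms by (auto intro!: level_scale_strict_antimono)
  define s where "s = (?l q - ?l r) / (?l p - ?l r)"
  have s: "0 < s" "s < 1" using l by (auto simp: s_def)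
  have "s * (?l p - ?l r) = ?l q - ?l r" using l by (simp add: s_def)
  then have eq: "?l q = (1 - s) * ?l r + s * ?l p" by (simp add: algebra_simps)
  have "(1 - s) * f (?l r) + s * f (?l p) \<le> f (?l q)"
    using concave_onD[OF f(1), of s "?l r" "?l p"] s assms(4-7) unfolding eq by simp
  moreover have "Q_bound M \<alpha> X p = ereal (f (?l p))" "Q_bound M \<alpha> X q = ereal (f (?l q))"
    "Q_bound M \<alpha> X r = ereal (f (?l r))" using assms(4-7) by (simp_all add: f(2))
  ultimately show ?thesis using that[OF s] by simp
qed

section \<open>Strict monotonicity and sensitivity\<close>

text \<open>The complement of the support is the union of all open null sets; by Lindelof countably
  many of them suffice, so it is null.\<close>

lemma AE_supp_rv:
  assumes [measurable]: "X \<in> borel_measurable M" and "prob_space M"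
  shows "AE \<omega> in M. X \<omega> \<in> supp_rv M X"
proof -
  interpret prob_space M by fact
  let ?D = "distr M borel X"
  interpret D: prob_space ?D by (rule prob_space_distr) measurable
  define F where "F = {U. open U \<and> measure ?D U = 0}"
  obtain F' where F': "F' \<subseteq> F" "countable F'" "\<Union>F' = \<Union>F"
    using Lindelof[of F] unfolding F_def by blast
  have "(\<Union>U\<in>F'. U) \<in> null_sets ?D"
    using F'(1) by (intro null_sets_UN' F'(2)) (auto simp: F_def D.emeasure_eq_measure null_sets_def)
  then have "\<Union>F \<in> null_sets ?D" using F'(3) by simp
  then have "AE \<omega> in M. X \<omega> \<notin> \<Union>F"
    by (intro AE_distrD[of X M borel] AE_not_in) measurable
  then show ?thesis
    by eventually_elim (auto simp: F_def supp_rv_def order_less_le)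
qed

lemma AE_le_x_star:
  assumes "X \<in> borel_measurable M" "prob_space M"
  shows "AE \<omega> in M. ereal (X \<omega>) \<le> x_star M X"
  using AE_supp_rv[OF assms] by eventually_elim (auto simp: x_star_def intro: SUP_upper)

lemma emeasure_ge_pos_of_less_x_star:
  assumes [measurable]: "X \<in> borel_measurable M" and "prob_space M" "ereal m < x_star M X"
  obtains y where "m < y" "0 < emeasure M {\<omega> \<in> space M. y \<le> X \<omega>}"
proof -
  interpret prob_space M by fact
  obtain s where s: "s \<in> supp_rv M X" "m < s"
    using assms(3) unfolding x_star_def less_Sup_iff by auto
  define y where "y = (m + s) / 2"
  have y: "m < y" "y < s" using s by (auto simp: y_def)
  have "0 < measure (distr M borel X) {y<..}" using s(1) y unfolding supp_rv_def by auto
  also have "\<dots> = measure M {\<omega> \<in> space M. y < X \<omega>}"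
    by (subst measure_distr) (auto intro!: arg_cong[of _ _ "measure M"])
  also have "\<dots> \<le> measure M {\<omega> \<in> space M. y \<le> X \<omega>}" by (rule finite_measure_mono) auto
  finally show ?thesis using that[OF y(1)] by (simp add: emeasure_eq_measure)
qed

text \<open>The points \<open>m - 1 / n\<^sup>2\<close> with scale \<open>l = n\<close> make the integrand \<open>h_fun \<alpha> (n (X - m) + 1 / n)\<close>,
  which tends to the indicator of \<open>X = m\<close>.\<close>

lemma Q_bound_less_of_AE_le:
  assumes "prob_space M" and [measurable]: "X \<in> borel_measurable M" and "0 < \<alpha>"
    and le: "AE \<omega> in M. X \<omega> \<le> m" and q: "emeasure M {\<omega> \<in> space M. X \<omega> = m} < ennreal q"
  shows "Q_bound M \<alpha> X q < ereal m"
proof -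
  interpret prob_space M by fact
  define r where "r n = real (Suc n)" for n
  have r: "0 < r n" for n by (simp add: r_def)
  have r_lim: "filterlim r at_top sequentially"
    unfolding r_def by (rule filterlim_compose[OF filterlim_real_sequentially filterlim_Suc])
  have inv_lim: "(\<lambda>n. 1 / r n) \<longlonglongrightarrow> 0"
    by (intro tendsto_divide_0[OF tendsto_const] filterlim_at_top_imp_at_infinity r_lim)
  let ?u = "\<lambda>n \<omega>. ennreal (h_fun \<alpha> (r n * (X \<omega> - m) + 1 / r n))"
  have "(\<lambda>n. \<integral>\<^sup>+ \<omega>. ?u n \<omega> \<partial>M) \<longlonglongrightarrow> (\<integral>\<^sup>+ \<omega>. indicator {\<omega> \<in> space M. X \<omega> = m} \<omega> \<partial>M)"
  proof (rule nn_integral_dominated_convergence[where w="\<lambda>_. ennreal (h_fun \<alpha> 1)"])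
    fix n
    show "AE \<omega> in M. ?u n \<omega> \<le> ennreal (h_fun \<alpha> 1)"
      using le
    proof eventually_elim
      case (elim \<omega>)
      have "r n * (X \<omega> - m) \<le> 0" using elim r[of n] by (simp add: mult_nonneg_nonpos)
      moreover have "1 / r n \<le> 1" by (simp add: r_def)
      ultimately show ?case by (intro ennreal_leI h_fun_mono) linarith
    qed
  next
    show "AE \<omega> in M. (\<lambda>n. ?u n \<omega>) \<longlonglongrightarrow> indicator {\<omega> \<in> space M. X \<omega> = m} \<omega>"
      using le AE_space
    proof eventually_elim
      case (elim \<omega>)
      show ?case
      proof (cases "X \<omega> = m")
        case True
        have "(\<lambda>n. h_fun \<alpha> (1 / r n)) \<longlonglongrightarrow> h_fun \<alpha> 0"
          by (intro tendsto_h_fun assms(3) tendsto_const inv_lim)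
        then have "(\<lambda>n. ennreal (h_fun \<alpha> (1 / r n))) \<longlonglongrightarrow> ennreal 1" by (intro tendsto_ennrealI) simp
        then show ?thesis using True elim by simp
      next
        case False
        then have neg: "X \<omega> - m < 0" using elim by simp
        have "filterlim (\<lambda>n. (m - X \<omega>) * r n) at_top sequentially"
          using neg by (intro filterlim_tendsto_pos_mult_at_top[OF tendsto_const _ r_lim]) simp
        then have "filterlim (\<lambda>n. - (1 / r n) + (m - X \<omega>) * r n) at_top sequentially"
          by (rule filterlim_tendsto_add_at_top[OF tendsto_minus[OF inv_lim]])
        then have "filterlim (\<lambda>n. 1 / r n + (X \<omega> - m) * r n) at_bot sequentially"
          unfolding filterlim_uminus_at_bot by (simp add: algebra_simps)
        then have "(\<lambda>n. h_fun \<alpha> (1 / r n + (X \<omega> - m) * r n)) \<longlonglongrightarrow> 0"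
          by (rule filterlim_compose[OF h_fun_tendsto_0])
        then have "(\<lambda>n. ennreal (h_fun \<alpha> (1 / r n + (X \<omega> - m) * r n))) \<longlonglongrightarrow> ennreal 0"
          by (rule tendsto_ennrealI)
        then show ?thesis using False by (simp add: add.commute mult.commute)
      qed
    qed
  qed (auto simp: emeasure_space_1)
  then have "(\<lambda>n. \<integral>\<^sup>+ \<omega>. ?u n \<omega> \<partial>M) \<longlonglongrightarrow> emeasure M {\<omega> \<in> space M. X \<omega> = m}" by simp
  then have "\<forall>\<^sub>F n in sequentially. (\<integral>\<^sup>+ \<omega>. ?u n \<omega> \<partial>M) < ennreal q" using q by (rule order_tendstoD)
  then obtain n where n: "(\<integral>\<^sup>+ \<omega>. ?u n \<omega> \<partial>M) < ennreal q" by (auto simp: eventually_sequentially)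
  have "r n * (X \<omega> - (m - 1 / (r n)\<^sup>2)) = r n * (X \<omega> - m) + 1 / r n" for \<omega>
    using r[of n] by (simp add: field_simps power2_eq_square)
  then have "P_bound M \<alpha> X (m - 1 / (r n)\<^sup>2) < ennreal q"
    unfolding P_bound_less_iff using n r[of n] by (intro exI[of _ "r n"]) simp
  then have "Q_bound M \<alpha> X q \<le> ereal (m - 1 / (r n)\<^sup>2)" by (rule Q_bound_le)
  also have "\<dots> < ereal m" using r[of n] by simp
  finally show ?thesis .
qed

text \<open>If the values at p and q agree, say equal m, concavity keeps the bound at most m for all
  smaller levels, which forces X below m almost surely. The atom at m then has mass at most
  \<open>p_star M X\<close>, hence less than q, and this pushes the value at q strictly below
  m.\<close>

lemma Q_bound_strict_antimono:
  assumes M: "prob_space M" and "0 < \<alpha>" and X: "X \<in> rv_class M \<alpha>"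
    and pq: "p_star M X \<le> p" "0 < p" "p < q" "q < 1"
  shows "Q_bound M \<alpha> X q < Q_bound M \<alpha> X p"
proof (rule ccontr)
  interpret prob_space M by fact
  have [measurable]: "X \<in> borel_measurable M" using X by (rule rv_class_measurable)
  assume "\<not> ?thesis"
  then have eq: "Q_bound M \<alpha> X q = Q_bound M \<alpha> X p"
    using Q_bound_antimono[of p q M \<alpha> X] pq by simp
  have fin: "\<bar>Q_bound M \<alpha> X q'\<bar> \<noteq> \<infinity>" if "0 < q'" "q' < 1" for q'
    using Q_bound_finite[OF M that X] .
  obtain m where m: "Q_bound M \<alpha> X p = ereal m" using fin[of p] pq by (cases "Q_bound M \<alpha> X p") auto
  \<comment> \<open>On the level scale p lies between q and p'; equal values at q and p leave a
    concave function no room to rise afterwards.\<close>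
  have const: "Q_bound M \<alpha> X p' \<le> ereal m" if p': "0 < p'" "p' < p" for p'
  proof -
    obtain k where k: "Q_bound M \<alpha> X p' = ereal k"
      using fin[of p'] pq p' by (cases "Q_bound M \<alpha> X p'") auto
    obtain s where s: "0 < s" "s < 1"
      "ereal (1 - s) * Q_bound M \<alpha> X q + ereal s * Q_bound M \<alpha> X p' \<le> Q_bound M \<alpha> X p"
      using Q_bound_three_levels[OF M assms(2) X p' pq(3,4)] by blast
    then have "(1 - s) * m + s * k \<le> m" using eq m k by simp
    then have "s * k \<le> s * m" by (simp add: algebra_simps)
    then show ?thesis using s k by simp
  qed
  have "x_star M X \<le> ereal m"
  proof (rule ccontr)
    assume "\<not> x_star M X \<le> ereal m"
    then have "ereal m < x_star M X" by simp
    from emeasure_ge_pos_of_less_x_star[OF rv_class_measurable[OF X] M this] obtain y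
      where y: "m < y" "0 < emeasure M {\<omega> \<in> space M. y \<le> X \<omega>}" .
    \<comment> \<open>A level not exceeding the mass beyond y makes the quantile bound at least y,
      which exceeds m; halving p keeps it strictly below p.\<close>
    define p' where "p' = min (p / 2) (measure M {\<omega> \<in> space M. y \<le> X \<omega>})"
    have p': "0 < p'" "p' < p" using y pq by (auto simp: p'_def emeasure_eq_measure)
    have "ereal y \<le> Q_bound M \<alpha> X p'"
      by (rule Q_bound_ge_prob) (auto simp: p'_def emeasure_eq_measure intro!: ennreal_leI)
    also have "\<dots> \<le> ereal m" by (rule const[OF p'])
    finally show False using y by simp
  qed
  then have le: "AE \<omega> in M. X \<omega> \<le> m"
    using AE_le_x_star[of X M] M by (auto elim!: eventually_mono order_trans simp flip: ereal_less_eq(3))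
  have "measure M {\<omega> \<in> space M. X \<omega> = m} \<le> p_star M X"
    unfolding p_star_def
  proof (rule finite_measure_mono_AE)
    show "AE \<omega> in M. \<omega> \<in> {\<omega> \<in> space M. X \<omega> = m} \<longrightarrow> \<omega> \<in> {\<omega> \<in> space M. ereal (X \<omega>) = x_star M X}"
      using AE_le_x_star[OF rv_class_measurable[OF X] M]
      by eventually_elim (use \<open>x_star M X \<le> ereal m\<close> in auto)
  qed measurable
  then have "emeasure M {\<omega> \<in> space M. X \<omega> = m} < ennreal q"
    using pq by (simp add: emeasure_eq_measure ennreal_less_iff)
  then have "Q_bound M \<alpha> X q < ereal m" by (intro Q_bound_less_of_AE_le M assms(2) le) measurable
  then show False using eq m by simp
qed

section \<open>Sensitivity of nonnegative variables\<close>

lemma prob_gt_pos_approx: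
  fixes X :: "'a \<Rightarrow> real"
  assumes "prob_space M" and [measurable]: "X \<in> borel_measurable M"
    and "r < measure M {\<omega> \<in> space M. 0 < X \<omega>}"
  obtains e where "0 < e" "r < measure M {\<omega> \<in> space M. e \<le> X \<omega>}"
proof -
  interpret prob_space M by fact
  define A where "A n = {\<omega> \<in> space M. 1 / real (Suc n) \<le> X \<omega>}" for n
  have "range A \<subseteq> sets M" by (auto simp: A_def)
  moreover have "incseq A"
    unfolding A_def incseq_def by (auto elim!: order_trans[rotated] simp: frac_le)
  ultimately have "(\<lambda>n. measure M (A n)) \<longlonglongrightarrow> measure M (\<Union>n. A n)"
    by (rule finite_Lim_measure_incseq)
  moreover have "(\<Union>n. A n) = {\<omega> \<in> space M. 0 < X \<omega>}"
  proof safe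
    fix \<omega> assume "\<omega> \<in> space M" "0 < X \<omega>"
    then show "\<omega> \<in> (\<Union>n. A n)"
      using reals_Archimedean[of "X \<omega>"] by (auto simp: A_def inverse_eq_divide intro: less_imp_le)
  next
    fix n \<omega> assume "\<omega> \<in> A n"
    then have "1 / real (Suc n) \<le> X \<omega>" by (simp add: A_def)
    moreover have "0 < 1 / real (Suc n)" by simp
    ultimately show "0 < X \<omega>" by (rule less_le_trans[rotated])
  qed (simp add: A_def)
  ultimately have "\<forall>\<^sub>F n in sequentially. r < measure M (A n)"
    using assms(3) by (auto dest: order_tendstoD)
  then obtain n where "r < measure M (A n)" by (auto simp: eventually_sequentially)
  then show ?thesis using that[of "1 / real (Suc n)"] by (simp add: A_def)
qed

lemma Q_bound_zero_sensitive:
  assumes "prob_space M" and [measurable]: "X \<in> borel_measurable M"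
    and "p < measure M {\<omega> \<in> space M. 0 < X \<omega>}"
  shows "0 < Q_bound M 0 X p"
proof -
  interpret prob_space M by fact
  obtain e where e: "0 < e" "p < measure M {\<omega> \<in> space M. e \<le> X \<omega>}"
    using prob_gt_pos_approx[OF assms] by blast
  then have "ereal e \<le> Q_bound M 0 X p"
    by (intro Q_bound_ge_prob) (auto simp: emeasure_eq_measure intro!: ennreal_leI)
  then show ?thesis using e(1) by (metis ereal_less(2) less_le_trans)
qed

text \<open>The bound is at least e at a sufficiently small level r and nonnegative at a level q
  above p; by concavity its value at the intermediate level p is at least a positive multiple of
  e.\<close>

lemma Q_bound_sensitive:
  assumes M: "prob_space M" and "0 < \<alpha>" and X: "X \<in> rv_class M \<alpha>" and p: "0 < p" "p < 1"
    and nn: "AE \<omega> in M. 0 \<le> X \<omega>" and pos: "0 < measure M {\<omega> \<in> space M. 0 < X \<omega>}"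
  shows "0 < Q_bound M \<alpha> X p"
proof -
  interpret prob_space M by fact
  have [measurable]: "X \<in> borel_measurable M" using X by (rule rv_class_measurable)
  obtain e where e: "0 < e" "0 < measure M {\<omega> \<in> space M. e \<le> X \<omega>}"
    using prob_gt_pos_approx[OF M _ pos] by auto
  define r where "r = min (p / 2) (measure M {\<omega> \<in> space M. e \<le> X \<omega>})"
  have r: "0 < r" "r < p" using e p by (auto simp: r_def)
  have Qr: "ereal e \<le> Q_bound M \<alpha> X r"
    by (rule Q_bound_ge_prob) (auto simp: r_def emeasure_eq_measure intro!: ennreal_leI)
  define q where "q = (p + 1) / 2"
  have q: "0 < q" "p < q" "q < 1" using p by (auto simp: q_def)
  have "Q_bound M \<alpha> (\<lambda>_. 0) q \<le> Q_bound M \<alpha> X q" using nn by (rule Q_bound_mono_AE)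
  then have Qq: "0 \<le> Q_bound M \<alpha> X q" using Q_bound_const[OF M q(1,3), of \<alpha> 0] by (metis zero_ereal_def)
  obtain s where s: "0 < s" "s < 1"
    "ereal (1 - s) * Q_bound M \<alpha> X q + ereal s * Q_bound M \<alpha> X r \<le> Q_bound M \<alpha> X p"
    using Q_bound_three_levels[OF M assms(2) X r q(2,3)] by blast
  have "0 < ereal s * ereal e" using s e by simp
  also have "\<dots> \<le> ereal s * Q_bound M \<alpha> X r" using s Qr by (intro ereal_mult_left_mono) auto
  also have "\<dots> \<le> ereal (1 - s) * Q_bound M \<alpha> X q + ereal s * Q_bound M \<alpha> X r"
    using Qq s by (simp add: add_increasing)
  finally show ?thesis using s(3) by simp
qed

section \<open>Stability\<close>

lemma Q_bound_ge_of_P_bound: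
  assumes "ennreal p \<le> P_bound M \<alpha> X x" shows "ereal x \<le> Q_bound M \<alpha> X p"
proof (rule Q_bound_geI)
  fix y assume "P_bound M \<alpha> X y < ennreal p"
  then show "ereal x \<le> ereal y"
    using assms P_bound_antimono[of y x M \<alpha> X] by (cases "x \<le> y") auto
qed

text \<open>This recovers the strictness lost in a limit: a tail bound that is only
  \<open>\<le> p\<close> is strictly below every larger level, and continuity in the level leads
  back to p.\<close>

lemma Q_bound_le_of_right_levels:
  assumes "prob_space M" "0 < \<alpha>" "X \<in> rv_class M \<alpha>" "0 < p" "p < 1"
    and le: "\<And>q. p < q \<Longrightarrow> q < 1 \<Longrightarrow> Q_bound M \<alpha> X q \<le> y"
  shows "Q_bound M \<alpha> X p \<le> y"
proof -
  \<comment> \<open>The offset 2 keeps already the first term strictly below 1.\<close>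
  define q where "q n = p + (1 - p) * (1 / real (n + 2))" for n
  have "(\<lambda>n. 1 / real (n + 2)) \<longlonglongrightarrow> 0"
    using lim_1_over_n by (rule LIMSEQ_ignore_initial_segment)
  from tendsto_add[OF tendsto_const tendsto_mult_right_zero[OF this]]
  have q_lim: "q \<longlonglongrightarrow> p" unfolding q_def by simp
  have q: "p < q n" "q n < 1" for n
  proof -
    have "(1 - p) * (1 / real (n + 2)) < (1 - p) * 1"
      using assms(5) by (intro mult_strict_left_mono) auto
    then show "q n < 1" by (simp add: q_def)
    show "p < q n" using assms(5) by (simp add: q_def)
  qed
  have "(\<lambda>n. Q_bound M \<alpha> X (q n)) \<longlonglongrightarrow> Q_bound M \<alpha> X p"
    using continuous_on_tendsto_compose[OF continuous_on_Q_bound[OF assms(1-3)] q_lim] assms(4,5) q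
    by (auto intro: always_eventually less_trans)
  then show ?thesis using le q by (intro LIMSEQ_le_const2) auto
qed

text \<open>Lower semicontinuity.  If the conclusion fails, extract scales \<open>l\<^sub>n\<close> witnessing the failure and
  converging in \<open>[0, \<infinity>]\<close>, and apply Fatou's lemma: the limit \<open>0\<close> gives \<open>1 \<le> p\<close>, the limit \<open>\<infinity>\<close>
  gives \<open>X \<le> x\<close> almost surely, and a finite positive limit witnesses \<open>P_bound M \<alpha> X x \<le> ennreal p\<close>.\<close>

lemma eventually_P_bound_ge:
  fixes as :: "nat \<Rightarrow> ennreal" and Xs :: "nat \<Rightarrow> 'a \<Rightarrow> real"
  assumes M: "prob_space M" and Xs [measurable]: "\<And>n. Xs n \<in> borel_measurable M"
    and \<alpha>: "0 < \<alpha>" and X: "X \<in> rv_class M \<alpha>" and as: "as \<longlonglongrightarrow> \<alpha>"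
    and lim: "\<And>\<omega>. \<omega> \<in> space M \<Longrightarrow> (\<lambda>n. Xs n \<omega>) \<longlonglongrightarrow> X \<omega>"
    and p: "0 < p" "p < 1" and x: "ereal x < Q_bound M \<alpha> X p"
  shows "\<forall>\<^sub>F n in sequentially. ennreal p \<le> P_bound M (as n) (Xs n) x"
proof (rule ccontr)
  interpret prob_space M by fact
  have [measurable]: "X \<in> borel_measurable M" using X by (rule rv_class_measurable)
  assume "\<not> ?thesis"
  then obtain r :: "nat \<Rightarrow> nat" where r: "strict_mono r"
    "\<And>n. P_bound M (as (r n)) (Xs (r n)) x < ennreal p"
    by (auto dest!: not_eventually_sequentiallyD simp: not_le)
  then have "\<forall>n. \<exists>l>0. (\<integral>\<^sup>+ \<omega>. ennreal (h_fun (as (r n)) (l * (Xs (r n) \<omega> - x))) \<partial>M) < ennreal p"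
    unfolding P_bound_less_iff by blast
  then obtain l where l: "\<And>n. 0 < l n"
    "\<And>n. (\<integral>\<^sup>+ \<omega>. ennreal (h_fun (as (r n)) (l n * (Xs (r n) \<omega> - x))) \<partial>M) < ennreal p"
    by metis
  obtain L s where s: "strict_mono s" "((\<lambda>n. ennreal (l n)) \<circ> s) \<longlonglongrightarrow> L"
    using compact_complete_linorder[of "\<lambda>n. ennreal (l n)"] by blast
  define k where "k = r \<circ> s"
  define u where "u n = l (s n)" for n
  have k: "filterlim k at_top sequentially"
    unfolding k_def using r(1) s(1) by (intro filterlim_subseq strict_mono_o)
  have u: "(\<lambda>n. ennreal (u n)) \<longlonglongrightarrow> L" "\<And>n. 0 < u n" using s(2) l(1) by (auto simp: u_def comp_def)
  have as_k: "(\<lambda>n. as (k n)) \<longlonglongrightarrow> \<alpha>" by (rule filterlim_compose[OF as k])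
  have X_k: "(\<lambda>n. Xs (k n) \<omega> - x) \<longlonglongrightarrow> X \<omega> - x" if "\<omega> \<in> space M" for \<omega>
    by (intro tendsto_diff tendsto_const filterlim_compose[OF lim[OF that] k])
  let ?h = "\<lambda>n \<omega>. ennreal (h_fun (as (k n)) (u n * (Xs (k n) \<omega> - x)))"
  have "(\<integral>\<^sup>+ \<omega>. liminf (\<lambda>n. ?h n \<omega>) \<partial>M) \<le> liminf (\<lambda>n. \<integral>\<^sup>+ \<omega>. ?h n \<omega> \<partial>M)"
    by (rule nn_integral_liminf) measurable
  also have "\<dots> \<le> limsup (\<lambda>n. \<integral>\<^sup>+ \<omega>. ?h n \<omega> \<partial>M)" by (rule Liminf_le_Limsup) simp
  also have "\<dots> \<le> ennreal p"
    using l(2) by (intro Limsup_bounded always_eventually) (auto simp: k_def u_def intro: less_imp_le)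
  finally have fatou: "(\<integral>\<^sup>+ \<omega>. liminf (\<lambda>n. ?h n \<omega>) \<partial>M) \<le> ennreal p" .
  show False
  proof (cases L)
    case top
    \<comment> \<open>A fixed finite index below \<alpha> is eventually below
      \<open>as (k n)\<close>, so its \<open>h_fun\<close> is a lower bound that does not change
      with n.\<close>
    obtain a where a: "0 < a" "ennreal a < \<alpha>"
    proof -
      obtain c where "0 < c" "c < \<alpha>" using dense[OF \<alpha>] by blast
      then show ?thesis using that by (cases c) auto
    qed
    have u_top: "filterlim u at_top sequentially"
      unfolding filterlim_at_top_dense
    proof
      fix K :: real
      have "\<forall>\<^sub>F n in sequentially. ennreal (max 0 K) < ennreal (u n)"
        using u(1) top by (intro order_tendstoD(1)) auto
      then show "\<forall>\<^sub>F n in sequentially. K < u n" by eventually_elim (subst (asm) ennreal_less_iff, auto)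
    qed
    have inf: "liminf (\<lambda>n. ?h n \<omega>) = \<top>" if \<omega>: "\<omega> \<in> space M" "x < X \<omega>" for \<omega>
    proof -
      have "filterlim (\<lambda>n. (Xs (k n) \<omega> - x) * u n) at_top sequentially"
        using \<omega> by (intro filterlim_tendsto_pos_mult_at_top[OF X_k _ u_top]) auto
      then have *: "filterlim (\<lambda>n. h_fun (ennreal a) (u n * (Xs (k n) \<omega> - x))) at_top sequentially"
        using filterlim_compose[OF filterlim_h_fun_at_top[OF a(1)]] by (simp add: mult.commute)
      have "\<forall>\<^sub>F n in sequentially. ennreal a < as (k n)" using as_k a(2) by (rule order_tendstoD)
      then have "filterlim (\<lambda>n. h_fun (as (k n)) (u n * (Xs (k n) \<omega> - x))) at_top sequentially"
        by (intro filterlim_at_top_mono[OF *]) (auto elim!: eventually_mono intro!: h_fun_mono_index)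
      then have "(\<lambda>n. ?h n \<omega>) \<longlonglongrightarrow> \<top>" by (rule ennreal_tendsto_top_eq_at_top[THEN iffD2])
      then show ?thesis by (simp add: lim_imp_Liminf)
    qed
    \<comment> \<open>The liminf is infinite where X exceeds x, yet its integral is at most p; that
      event is therefore null.\<close>
    have "AE \<omega> in M. liminf (\<lambda>n. ?h n \<omega>) \<noteq> \<infinity>"
      by (rule nn_integral_PInf_AE) (use fatou in \<open>auto simp: top_unique\<close>)
    then have "AE \<omega> in M. X \<omega> \<le> x"
      using AE_space by eventually_elim (use inf in force)
    then have "Q_bound M \<alpha> X p \<le> Q_bound M \<alpha> (\<lambda>_. x) p" by (rule Q_bound_mono_AE)
    then show False using x Q_bound_const[OF M p, of \<alpha> x] by simp
  next
    case (real l0)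
    have "(\<lambda>n. enn2real (ennreal (u n))) \<longlonglongrightarrow> enn2real L"
      using u(1) real by (intro tendsto_enn2real) auto
    then have u_lim: "u \<longlonglongrightarrow> l0" using u(2) real by (simp add: less_imp_le)
    have "liminf (\<lambda>n. ?h n \<omega>) = ennreal (h_fun \<alpha> (l0 * (X \<omega> - x)))" if "\<omega> \<in> space M" for \<omega>
    proof -
      have "(\<lambda>n. ?h n \<omega>) \<longlonglongrightarrow> ennreal (h_fun \<alpha> (l0 * (X \<omega> - x)))"
        by (intro tendsto_ennrealI tendsto_h_fun \<alpha> as_k tendsto_mult u_lim X_k that)
      then show ?thesis by (simp add: lim_imp_Liminf)
    qed
    then have "(\<integral>\<^sup>+ \<omega>. liminf (\<lambda>n. ?h n \<omega>) \<partial>M) = (\<integral>\<^sup>+ \<omega>. ennreal (h_fun \<alpha> (l0 * (X \<omega> - x))) \<partial>M)"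
      by (intro nn_integral_cong)
    with fatou have le: "(\<integral>\<^sup>+ \<omega>. ennreal (h_fun \<alpha> (l0 * (X \<omega> - x))) \<partial>M) \<le> ennreal p" by simp
    show False
    proof (cases "l0 = 0")
      case True
      then show False using le p by (simp add: emeasure_space_1 ennreal_ge_1)
    next
      case False
      then have "0 < l0" using real by simp
      \<comment> \<open>The limiting scale gives only \<open>\<le> p\<close>, which is not enough at
        level p itself but suffices at every larger level.\<close>
      have "Q_bound M \<alpha> X q \<le> ereal x" if "p < q" "q < 1" for q
      proof (rule Q_bound_le)
        have "ennreal p < ennreal q" using that p by (simp add: ennreal_less_iff)
        then show "P_bound M \<alpha> X x < ennreal q"
          unfolding P_bound_less_iff using le \<open>0 < l0\<close> by (meson le_less_trans)
      qed
      then have "Q_bound M \<alpha> X p \<le> ereal x" using Q_bound_le_of_right_levels[OF M \<alpha> X p] by blast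
      then show False using x by simp
    qed
  qed
qed

lemma tendsto_ereal_sandwichI:
  fixes f :: "'c \<Rightarrow> ereal"
  assumes "\<And>x. ereal x < y \<Longrightarrow> \<forall>\<^sub>F n in F. ereal x \<le> f n"
    and "\<And>x. y < ereal x \<Longrightarrow> \<forall>\<^sub>F n in F. f n \<le> ereal x"
  shows "(f \<longlongrightarrow> y) F"
proof (rule order_tendstoI)
  fix c assume "c < y"
  then obtain x where x: "c < ereal x" "ereal x < y" using ereal_dense2 by blast
  from assms(1)[OF x(2)] show "\<forall>\<^sub>F n in F. c < f n"
    by eventually_elim (use x(1) in simp)
next
  fix c assume "y < c"
  then obtain x where x: "y < ereal x" "ereal x < c" using ereal_dense2 by blast
  from assms(2)[OF x(1)] show "\<forall>\<^sub>F n in F. f n < c"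
    by eventually_elim (use x(2) in simp)
qed

section \<open>Growth bounds and upper limits\<close>

lemma h_fun_le_pos_powr:
  assumes "0 < a" "0 < l"
  obtains C where "0 \<le> C" "\<And>u. 1 \<le> u \<Longrightarrow> h_fun (ennreal a) (l * (u - x)) \<le> C * pos_powr u a"
proof (rule that)
  \<comment> \<open>For \<open>1 \<le> u\<close> both the constant 1 and the shift by x are absorbed
    into multiples of u, so \<open>D * u\<close> bounds the affine argument.\<close>
  define D where "D = 1 + l * (1 + \<bar>x\<bar>) / a"
  have "0 \<le> D" using assms by (simp add: D_def)
  show "0 \<le> D powr a" by simp
  fix u :: real assume u: "1 \<le> u"
  have "l * (u - x) / a \<le> l * (u * (1 + \<bar>x\<bar>)) / a"
  proof -
    have "- x \<le> \<bar>x\<bar>" "\<bar>x\<bar> \<le> u * \<bar>x\<bar>" using mult_right_mono[OF u, of "\<bar>x\<bar>"] by auto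
    then have "u - x \<le> u * (1 + \<bar>x\<bar>)" unfolding distrib_left by linarith
    then show ?thesis using assms by (intro divide_right_mono mult_left_mono) auto
  qed
  then have "1 + l * (u - x) / a \<le> D * u"
    using u by (simp add: D_def algebra_simps)
  then have "pos_powr (1 + l * (u - x) / a) a \<le> pos_powr (D * u) a"
    using assms by (intro pos_powr_mono) auto
  then show "h_fun (ennreal a) (l * (u - x)) \<le> D powr a * pos_powr u a"
    using assms \<open>0 \<le> D\<close> by (simp add: h_fun_finite pos_powr_scale)
qed

lemma nn_integral_h_fun_finite:
  assumes "prob_space M" "0 < a" "0 < l" "X \<in> rv_class M (ennreal a)"
  shows "(\<integral>\<^sup>+ \<omega>. ennreal (h_fun (ennreal a) (l * (X \<omega> - x))) \<partial>M) < \<infinity>"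
proof -
  interpret prob_space M by fact
  have [measurable]: "X \<in> borel_measurable M" using assms(4) by (rule rv_class_measurable)
  obtain C where C: "0 \<le> C" "\<And>u. 1 \<le> u \<Longrightarrow> h_fun (ennreal a) (l * (u - x)) \<le> C * pos_powr u a"
    using h_fun_le_pos_powr[OF assms(2,3)] by blast
  let ?B = "h_fun (ennreal a) (l * (1 - x))"
  have "h_fun (ennreal a) (l * (u - x)) \<le> ?B + C * pos_powr u a" for u
  proof (cases "1 \<le> u")
    case True
    then show ?thesis using C(2)[OF True] by (simp add: add_increasing)
  next
    case False
    then have "h_fun (ennreal a) (l * (u - x)) \<le> ?B" using assms(3) by (intro h_fun_mono) simp
    then show ?thesis using C(1) by (simp add: add_increasing2 pos_powr_def)
  qed
  then have "(\<integral>\<^sup>+ \<omega>. ennreal (h_fun (ennreal a) (l * (X \<omega> - x))) \<partial>M)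
      \<le> (\<integral>\<^sup>+ \<omega>. ennreal ?B + ennreal C * ennreal (pos_powr (X \<omega>) a) \<partial>M)"
    using C(1) by (intro nn_integral_mono) (simp add: pos_powr_def ennreal_leI flip: ennreal_mult ennreal_plus)
  also have "\<dots> = ennreal ?B + ennreal C * (\<integral>\<^sup>+ \<omega>. ennreal (pos_powr (X \<omega>) a) \<partial>M)"
    by (simp add: nn_integral_add nn_integral_cmult emeasure_space_1)
  also have "\<dots> < \<infinity>"
    using assms(2,4) by (simp add: rv_class_def ennreal_mult_less_top)
  finally show ?thesis .
qed

text \<open>The upper half keeps one scale that works for the limit index and applies dominated
  convergence under \<open>h_fun\<close> at the supremum of the indices. For infinite \<alpha>,
  monotonicity in the index gives the upper half directly.\<close>

lemma tendsto_Q_bound_index: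
  fixes as :: "nat \<Rightarrow> ennreal"
  assumes M: "prob_space M" and \<alpha>: "0 < \<alpha>" and X: "X \<in> rv_class M \<alpha>" and p: "0 < p" "p < 1"
    and as: "\<And>n. as n < \<infinity>" "as \<longlonglongrightarrow> \<alpha>" and X': "X \<in> rv_class M (SUP n. as n)"
  shows "(\<lambda>n. Q_bound M (as n) X p) \<longlonglongrightarrow> Q_bound M \<alpha> X p"
proof (rule tendsto_ereal_sandwichI)
  interpret prob_space M by fact
  have [measurable]: "X \<in> borel_measurable M" using X by (rule rv_class_measurable)
  fix x assume "ereal x < Q_bound M \<alpha> X p"
  then have "\<forall>\<^sub>F n in sequentially. ennreal p \<le> P_bound M (as n) X x"
    using eventually_P_bound_ge[OF M _ \<alpha> X as(2) _ p, of "\<lambda>_. X" x] by simp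
  then show "\<forall>\<^sub>F n in sequentially. ereal x \<le> Q_bound M (as n) X p"
    by eventually_elim (rule Q_bound_ge_of_P_bound)
next
  interpret prob_space M by fact
  have [measurable]: "X \<in> borel_measurable M" using X by (rule rv_class_measurable)
  fix x assume x: "Q_bound M \<alpha> X p < ereal x"
  show "\<forall>\<^sub>F n in sequentially. Q_bound M (as n) X p \<le> ereal x"
  proof (cases "\<alpha> = \<infinity>")
    case True
    then have "Q_bound M (as n) X p \<le> Q_bound M \<alpha> X p" for n by (intro Q_bound_mono_index) simp
    then show ?thesis using x by (intro always_eventually) (auto intro: order_trans less_imp_le)
  next
    case False
    define \<beta> where "\<beta> = (SUP n. as n)"
    have as_le: "as n \<le> \<beta>" for n by (simp add: \<beta>_def SUP_upper)
    then have "\<alpha> \<le> \<beta>" using as(2) by (intro LIMSEQ_le_const2) auto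
    \<comment> \<open>Convergence to a finite limit bounds all but finitely many indices by
      \<open>\<alpha> + 1\<close>; the remaining ones are finite and bounded by their sum.\<close>
    have "\<beta> < \<infinity>"
    proof -
      have "\<alpha> < \<alpha> + 1" using False by (cases \<alpha>) (auto simp: ennreal_less_iff simp flip: ennreal_1 ennreal_plus)
      with as(2) have "\<forall>\<^sub>F n in sequentially. as n < \<alpha> + 1" by (rule order_tendstoD)
      then obtain N where N: "\<And>n. N \<le> n \<Longrightarrow> as n < \<alpha> + 1" by (auto simp: eventually_sequentially)
      have "as n \<le> (\<alpha> + 1) + (\<Sum>i<N. as i)" for n
      proof (cases "N \<le> n")
        case True
        then show ?thesis using N[OF True] by (simp add: add_increasing2 less_imp_le)
      next
        case False
        then have "as n \<le> (\<Sum>i<N. as i)" by (intro member_le_sum) auto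
        then show ?thesis by (simp add: add_increasing)
      qed
      then have "\<beta> \<le> (\<alpha> + 1) + (\<Sum>i<N. as i)" unfolding \<beta>_def by (rule SUP_least)
      also have "\<dots> < \<infinity>" using as(1) False by (simp add: ennreal_sum_less_top less_top)
      finally show ?thesis .
    qed
    then obtain b where b: "0 < b" "\<beta> = ennreal b"
      using ennreal_pos_finiteE[of \<beta>] \<alpha> \<open>\<alpha> \<le> \<beta>\<close> by (metis less_irrefl leD)
    obtain l where l: "0 < l" "(\<integral>\<^sup>+ \<omega>. ennreal (h_fun \<alpha> (l * (X \<omega> - x))) \<partial>M) < ennreal p"
      using Q_bound_lessD[OF x] unfolding P_bound_less_iff by blast
    have "(\<lambda>n. \<integral>\<^sup>+ \<omega>. ennreal (h_fun (as n) (l * (X \<omega> - x))) \<partial>M)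
        \<longlonglongrightarrow> (\<integral>\<^sup>+ \<omega>. ennreal (h_fun \<alpha> (l * (X \<omega> - x))) \<partial>M)"
    proof (rule nn_integral_dominated_convergence[where w="\<lambda>\<omega>. ennreal (h_fun \<beta> (l * (X \<omega> - x)))"])
      show "(\<integral>\<^sup>+ \<omega>. ennreal (h_fun \<beta> (l * (X \<omega> - x))) \<partial>M) < \<infinity>"
        using nn_integral_h_fun_finite[OF M b(1) l(1)] X' b(2) by (simp add: \<beta>_def)
    qed (auto intro!: AE_I2 ennreal_leI h_fun_mono_index as_le tendsto_ennrealI tendsto_h_fun \<alpha> as(2))
    then have "\<forall>\<^sub>F n in sequentially. (\<integral>\<^sup>+ \<omega>. ennreal (h_fun (as n) (l * (X \<omega> - x))) \<partial>M) < ennreal p"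
      using l(2) by (rule order_tendstoD)
    then show ?thesis
      by eventually_elim (use l(1) in \<open>auto intro!: Q_bound_le simp: P_bound_less_iff\<close>)
  qed
qed

text \<open>Tail and quantile bounds depend only on the law, so Skorohod's representation may
  replace the variables by pointwise convergent ones on a single space. The lower half is then the
  Fatou argument; the upper half truncates at K, and the uniform tail condition controls the
  remainder.\<close>

lemma tendsto_Q_bound_distr:
  fixes N :: "nat \<Rightarrow> 'b measure" and Xs :: "nat \<Rightarrow> 'b \<Rightarrow> real" and X :: "'a \<Rightarrow> real"
  assumes M: "prob_space M" and \<alpha>: "0 < \<alpha>" and X: "X \<in> rv_class M \<alpha>" and p: "0 < p" "p < 1"
    and N: "\<And>n. prob_space (N n)" and Xs [measurable]: "\<And>n. Xs n \<in> borel_measurable (N n)"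
    and conv: "weak_conv_m (\<lambda>n. distr (N n) borel (Xs n)) (distr M borel X)"
    and fin: "\<alpha> < \<infinity> \<Longrightarrow> unif_tail_powr (enn2real \<alpha>) N Xs"
    and inf: "\<And>l. \<alpha> = \<infinity> \<Longrightarrow> l \<in> exp_moment_set M X \<Longrightarrow> unif_tail_exp l N Xs"
  shows "(\<lambda>n. Q_bound (N n) \<alpha> (Xs n) p) \<longlonglongrightarrow> Q_bound M \<alpha> X p"
proof -
  have Xm [measurable]: "X \<in> borel_measurable M" using X by (rule rv_class_measurable)
  have d1: "real_distribution (distr (N n) borel (Xs n))" for n
    using N[of n] by (intro prob_space.real_distribution_distr) auto
  have d2: "real_distribution (distr M borel X)"
    using M by (intro prob_space.real_distribution_distr) auto
  obtain \<Omega> :: "real measure" and Ys Y where \<Omega>: "prob_space \<Omega>"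
    and Ys [measurable]: "\<And>n. Ys n \<in> borel_measurable \<Omega>" and Y [measurable]: "Y \<in> borel_measurable \<Omega>"
    and dYs: "\<And>n. distr \<Omega> borel (Ys n) = distr (N n) borel (Xs n)"
    and dY: "distr \<Omega> borel Y = distr M borel X"
    and lim: "\<And>\<omega>. \<omega> \<in> space \<Omega> \<Longrightarrow> (\<lambda>n. Ys n \<omega>) \<longlonglongrightarrow> Y \<omega>"
    using Skorohod[OF d1 d2 conv] unfolding measurable_lborel1 by blast
  interpret \<Omega>: prob_space \<Omega> by fact
  have Y_class: "Y \<in> rv_class \<Omega> \<alpha>" by (rule rv_class_distr_eq[OF Y X dY])
  have QY: "Q_bound \<Omega> \<alpha> Y p = Q_bound M \<alpha> X p" by (rule Q_bound_distr_eq[OF Y Xm dY])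
  have QYs: "Q_bound \<Omega> \<alpha> (Ys n) p = Q_bound (N n) \<alpha> (Xs n) p" for n
    by (rule Q_bound_distr_eq[OF Ys Xs dYs])
  show ?thesis
  proof (rule tendsto_ereal_sandwichI)
    fix x assume "ereal x < Q_bound M \<alpha> X p"
    then have "\<forall>\<^sub>F n in sequentially. ennreal p \<le> P_bound \<Omega> \<alpha> (Ys n) x"
      by (intro eventually_P_bound_ge[OF \<Omega> Ys \<alpha> Y_class tendsto_const lim p]) (simp_all add: QY)
    then show "\<forall>\<^sub>F n in sequentially. ereal x \<le> Q_bound (N n) \<alpha> (Xs n) p"
      by eventually_elim (simp add: Q_bound_ge_of_P_bound flip: QYs)
  next
    fix x assume x: "Q_bound M \<alpha> X p < ereal x"
    obtain l where l: "0 < l" "(\<integral>\<^sup>+ \<omega>. ennreal (h_fun \<alpha> (l * (X \<omega> - x))) \<partial>M) < ennreal p"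
      using Q_bound_lessD[OF x] unfolding P_bound_less_iff by blast
    obtain j where j: "(\<integral>\<^sup>+ \<omega>. ennreal (h_fun \<alpha> (l * (X \<omega> - x))) \<partial>M) = ennreal j" "0 \<le> j" "j < p"
      using l(2) by (cases "\<integral>\<^sup>+ \<omega>. ennreal (h_fun \<alpha> (l * (X \<omega> - x))) \<partial>M") (auto simp: ennreal_less_iff)
    \<comment> \<open>Half of the gap pays for the limit of the truncated integrals, the other half
      for the uniform tail.\<close>
    define e where "e = (p - j) / 2"
    have e: "0 < e" using j by (simp add: e_def)
    \<comment> \<open>Both tail conditions are brought to one form: \<open>w\<close> is the power or
      exponential weight that dominates the integrand from 1 onwards.\<close>
    obtain C w where C: "0 \<le> C" "\<And>u. 1 \<le> u \<Longrightarrow> h_fun \<alpha> (l * (u - x)) \<le> C * w u"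
      and w: "\<And>u. 0 \<le> w u" "w \<in> borel_measurable borel"
      and tail: "((\<lambda>K::real. SUP n. \<integral>\<^sup>+ \<omega>. ennreal (w (Xs n \<omega>) * indicator {K<..} (Xs n \<omega>)) \<partial>(N n))
          \<longlongrightarrow> 0) at_top"
    proof (cases "\<alpha> = \<infinity>")
      case True
      have "ennreal (h_fun \<alpha> (l * (X \<omega> - x))) = ennreal (exp (- l * x)) * ennreal (exp (l * X \<omega>))" for \<omega>
        by (simp add: True h_fun_def right_diff_distrib flip: ennreal_mult exp_add)
      then have "ennreal (exp (- l * x)) * (\<integral>\<^sup>+ \<omega>. ennreal (exp (l * X \<omega>)) \<partial>M) < ennreal p"
        using l(2) by (simp add: nn_integral_cmult)
      \<comment> \<open>An infinite moment times a positive factor could not stay below p; so the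
        tail condition is available at this very scale.\<close>
      then have "l \<in> exp_moment_set M X"
        using l(1) unfolding exp_moment_set_def
        by (cases "\<integral>\<^sup>+ \<omega>. ennreal (exp (l * X \<omega>)) \<partial>M") (auto simp: ennreal_mult_top)
      then have "unif_tail_exp l N Xs" using inf True by blast
      then show ?thesis
        by (intro that[of "exp (- l * x)" "\<lambda>u. exp (l * u)"])
          (auto simp: unif_tail_exp_def True h_fun_def right_diff_distrib simp flip: exp_add)
    next
      case False
      then obtain a where a: "0 < a" "\<alpha> = ennreal a" "enn2real \<alpha> = a"
        using ennreal_pos_finiteE \<alpha> by (metis less_irrefl)
      obtain C where "0 \<le> C" "\<And>u. 1 \<le> u \<Longrightarrow> h_fun (ennreal a) (l * (u - x)) \<le> C * pos_powr u a"
        using h_fun_le_pos_powr[OF a(1) l(1)] by blast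
      moreover have "unif_tail_powr a N Xs" using fin a by simp
      ultimately show ?thesis
        using a(2) by (intro that[of C "\<lambda>u. pos_powr u a"]) (auto simp: unif_tail_powr_def pos_powr_def)
    qed
    \<comment> \<open>C may be 0; dividing by \<open>C + 1\<close> stays legitimate and still gives
      \<open>C * (e / (C + 1)) \<le> e\<close>.\<close>
    have "0 < ennreal (e / (C + 1))" using e C(1) by simp
    with tail have "\<forall>\<^sub>F K in at_top. (SUP n. \<integral>\<^sup>+ \<omega>. ennreal (w (Xs n \<omega>) * indicator {K<..} (Xs n \<omega>)) \<partial>(N n))
        < ennreal (e / (C + 1))"
      by (rule order_tendstoD)
    then have "\<forall>\<^sub>F K in at_top. (SUP n. \<integral>\<^sup>+ \<omega>. ennreal (w (Xs n \<omega>) * indicator {K<..} (Xs n \<omega>)) \<partial>(N n))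
        < ennreal (e / (C + 1)) \<and> 1 \<le> K"
      by (intro eventually_conj eventually_ge_at_top)
    then obtain K :: real where K: "1 \<le> K"
      "(SUP n. \<integral>\<^sup>+ \<omega>. ennreal (w (Xs n \<omega>) * indicator {K<..} (Xs n \<omega>)) \<partial>(N n)) < ennreal (e / (C + 1))"
      using eventually_happens' trivial_limit_at_top_linorder by blast
    have tail_n: "ennreal C * (\<integral>\<^sup>+ \<omega>. ennreal (w (Xs n \<omega>) * indicator {K<..} (Xs n \<omega>)) \<partial>(N n)) \<le> ennreal e" for n
    proof -
      have "(\<integral>\<^sup>+ \<omega>. ennreal (w (Xs n \<omega>) * indicator {K<..} (Xs n \<omega>)) \<partial>(N n)) \<le> ennreal (e / (C + 1))"
        using K(2) by (meson SUP_lessD UNIV_I less_imp_le)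
      then have "ennreal C * (\<integral>\<^sup>+ \<omega>. ennreal (w (Xs n \<omega>) * indicator {K<..} (Xs n \<omega>)) \<partial>(N n))
          \<le> ennreal C * ennreal (e / (C + 1))"
        by (rule mult_left_mono) simp
      also have "\<dots> = ennreal (C * (e / (C + 1)))" using C(1) e by (simp flip: ennreal_mult'')
      also have "\<dots> \<le> ennreal e" using C(1) e by (intro ennreal_leI) (simp add: field_simps)
      finally show ?thesis .
    qed
    \<comment> \<open>Capping the integrand at its value in K makes it bounded and continuous, so
      pointwise convergence passes to the integrals; the excess beyond K is charged to the
      tail.\<close>
    define f where "f u = min (h_fun \<alpha> (l * (u - x))) (h_fun \<alpha> (l * (K - x)))" for u
    have f [measurable]: "f \<in> borel_measurable borel" and f_nonneg: "0 \<le> f u" for u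
      unfolding f_def by measurable
    have h_le: "h_fun \<alpha> (l * (u - x)) \<le> f u + C * (w u * indicator {K<..} u)" for u
    proof (cases "u \<le> K")
      case True
      then have "h_fun \<alpha> (l * (u - x)) \<le> h_fun \<alpha> (l * (K - x))" using l(1) by (intro h_fun_mono) simp
      then show ?thesis using True by (simp add: f_def)
    next
      case False
      then show ?thesis using C(2)[of u] K(1) f_nonneg[of u] by simp
    qed
    have "(\<lambda>n. \<integral>\<^sup>+ \<omega>. ennreal (f (Ys n \<omega>)) \<partial>\<Omega>) \<longlonglongrightarrow> (\<integral>\<^sup>+ \<omega>. ennreal (f (Y \<omega>)) \<partial>\<Omega>)"
    proof (rule nn_integral_dominated_convergence[where w="\<lambda>_. ennreal (h_fun \<alpha> (l * (K - x)))"])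
      show "AE \<omega> in \<Omega>. (\<lambda>n. ennreal (f (Ys n \<omega>))) \<longlonglongrightarrow> ennreal (f (Y \<omega>))"
        unfolding f_def
        by (intro AE_I2 tendsto_ennrealI tendsto_min tendsto_const tendsto_h_fun \<alpha> tendsto_mult tendsto_diff lim)
    qed (auto simp: f_def ennreal_leI \<Omega>.emeasure_space_1)
    moreover have "(\<integral>\<^sup>+ \<omega>. ennreal (f (Y \<omega>)) \<partial>\<Omega>) = (\<integral>\<^sup>+ \<omega>. ennreal (f (X \<omega>)) \<partial>M)"
      by (rule nn_integral_distr_eq[OF Y Xm dY]) measurable
    moreover have "(\<integral>\<^sup>+ \<omega>. ennreal (f (Ys n \<omega>)) \<partial>\<Omega>) = (\<integral>\<^sup>+ \<omega>. ennreal (f (Xs n \<omega>)) \<partial>(N n))" for n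
      by (rule nn_integral_distr_eq[OF Ys Xs dYs]) measurable
    ultimately have f_lim: "(\<lambda>n. \<integral>\<^sup>+ \<omega>. ennreal (f (Xs n \<omega>)) \<partial>(N n)) \<longlonglongrightarrow> (\<integral>\<^sup>+ \<omega>. ennreal (f (X \<omega>)) \<partial>M)" by simp
    have "(\<integral>\<^sup>+ \<omega>. ennreal (f (X \<omega>)) \<partial>M) \<le> ennreal j"
      unfolding j(1)[symmetric] by (intro nn_integral_mono ennreal_leI) (simp add: f_def)
    also have "\<dots> < ennreal (j + e)" using j e by (simp add: ennreal_less_iff)
    finally have "\<forall>\<^sub>F n in sequentially. (\<integral>\<^sup>+ \<omega>. ennreal (f (Xs n \<omega>)) \<partial>(N n)) < ennreal (j + e)"
      using f_lim by (intro order_tendstoD)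
    then show "\<forall>\<^sub>F n in sequentially. Q_bound (N n) \<alpha> (Xs n) p \<le> ereal x"
    proof eventually_elim
      case (elim n)
      note w(2) [measurable]
      have "(\<integral>\<^sup>+ \<omega>. ennreal (h_fun \<alpha> (l * (Xs n \<omega> - x))) \<partial>(N n))
          \<le> (\<integral>\<^sup>+ \<omega>. ennreal (f (Xs n \<omega>))
              + ennreal C * ennreal (w (Xs n \<omega>) * indicator {K<..} (Xs n \<omega>)) \<partial>(N n))"
        using C(1) f_nonneg w(1) h_le
        by (intro nn_integral_mono) (simp add: ennreal_leI flip: ennreal_mult ennreal_plus)
      also have "\<dots> = (\<integral>\<^sup>+ \<omega>. ennreal (f (Xs n \<omega>)) \<partial>(N n))
          + ennreal C * (\<integral>\<^sup>+ \<omega>. ennreal (w (Xs n \<omega>) * indicator {K<..} (Xs n \<omega>)) \<partial>(N n))"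
        by (simp add: nn_integral_add nn_integral_cmult)
      also have "\<dots> \<le> (\<integral>\<^sup>+ \<omega>. ennreal (f (Xs n \<omega>)) \<partial>(N n)) + ennreal e"
        by (intro add_left_mono tail_n)
      also have "\<dots> < ennreal (j + e) + ennreal e"
        using elim by (simp add: add.commute[of _ "ennreal e"] ennreal_add_left_cancel_less)
      also have "\<dots> = ennreal p" using j e by (simp add: e_def flip: ennreal_plus)
      finally show ?case using l(1) by (intro Q_bound_le) (auto simp: P_bound_less_iff)
    qed
  qed
qed

section \<open>Subadditivity and convexity\<close>

lemma Q_bound_scale:
  assumes "prob_space M" "0 < p" "p < 1" "0 \<le> \<kappa>"
  shows "Q_bound M \<alpha> (\<lambda>\<omega>. \<kappa> * X \<omega>) p = ereal \<kappa> * Q_bound M \<alpha> X p"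
proof (cases "\<kappa> = 0")
  case True
  then show ?thesis using Q_bound_const[OF assms(1-3), of \<alpha> 0] by (simp add: zero_ereal_def[symmetric])
next
  case False
  then show ?thesis using assms(4) by (intro Q_bound_scale_pos) simp
qed

lemma Q_bound_subadditive:
  assumes M: "prob_space M" and p: "0 < p" "p < 1" and "1 \<le> \<alpha>"
    and X: "X \<in> rv_class M \<alpha>" and Y: "Y \<in> rv_class M \<alpha>"
  shows "Q_bound M \<alpha> (\<lambda>\<omega>. X \<omega> + Y \<omega>) p \<le> Q_bound M \<alpha> X p + Q_bound M \<alpha> Y p"
proof -
  obtain a where a: "Q_bound M \<alpha> X p = ereal a"
    using Q_bound_finite[OF M p X] by (cases "Q_bound M \<alpha> X p") auto
  obtain b where b: "Q_bound M \<alpha> Y p = ereal b"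
    using Q_bound_finite[OF M p Y] by (cases "Q_bound M \<alpha> Y p") auto
  have "Q_bound M \<alpha> (\<lambda>\<omega>. X \<omega> + Y \<omega>) p \<le> ereal (a + b)"
    unfolding Q_bound_le_iff
  proof (intro allI impI)
    fix z assume "a + b < z"
    \<comment> \<open>The tail bounds are known to be below p only strictly above a and b, so the
      slack is shared equally.\<close>
    define e where "e = (z - a - b) / 2"
    have e: "0 < e" "z = (a + e) + (b + e)" using \<open>a + b < z\<close> by (auto simp: e_def field_simps)
    show "P_bound M \<alpha> (\<lambda>\<omega>. X \<omega> + Y \<omega>) z < ennreal p"
      unfolding e(2) using e(1) a b
      by (intro P_bound_add assms(4) rv_class_measurable[OF X] rv_class_measurable[OF Y] Q_bound_lessD) auto
  qed
  then show ?thesis by (simp add: a b)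
qed

lemma rv_class_scale:
  assumes "X \<in> rv_class M \<alpha>" "0 < k" shows "(\<lambda>\<omega>. k * X \<omega>) \<in> rv_class M \<alpha>"
proof -
  have [measurable]: "X \<in> borel_measurable M" using assms(1) by (rule rv_class_measurable)
  have "(\<integral>\<^sup>+ \<omega>. ennreal (pos_powr (k * X \<omega>) a) \<partial>M) = ennreal (k powr a) * (\<integral>\<^sup>+ \<omega>. ennreal (pos_powr (X \<omega>) a) \<partial>M)" for a
    using assms(2) by (simp add: pos_powr_scale ennreal_mult' nn_integral_cmult)
  moreover have "l / k \<in> exp_moment_set M (\<lambda>\<omega>. k * X \<omega>)" if "l \<in> exp_moment_set M X" for l
    using that assms(2) by (simp add: exp_moment_set_def)
  ultimately show ?thesis using assms(1) unfolding rv_class_def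
    by (auto simp: ennreal_mult_less_top)
qed

text \<open>Subadditivity for the two weighted variables, followed by positive homogeneity.\<close>

lemma Q_bound_convex:
  assumes M: "prob_space M" and p: "0 < p" "p < 1" and \<alpha>: "1 \<le> \<alpha>"
    and X: "X \<in> rv_class M \<alpha>" and Y: "Y \<in> rv_class M \<alpha>" and t: "0 < t" "t < 1"
  shows "Q_bound M \<alpha> (\<lambda>\<omega>. (1 - t) * X \<omega> + t * Y \<omega>) p
    \<le> ereal (1 - t) * Q_bound M \<alpha> X p + ereal t * Q_bound M \<alpha> Y p"
proof -
  have "(\<lambda>\<omega>. (1 - t) * X \<omega>) \<in> rv_class M \<alpha>" "(\<lambda>\<omega>. t * Y \<omega>) \<in> rv_class M \<alpha>"
    using X Y t by (simp_all add: rv_class_scale)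
  from Q_bound_subadditive[OF M p \<alpha> this] show ?thesis
    using t by (simp add: Q_bound_scale_pos)
qed

theorem theorem2p4:
  fixes M :: "'a measure" and X :: "'a \<Rightarrow> real" and \<alpha> :: ennreal and p :: real
  assumes "prob_space M"
    and "0 < p" and "p < 1"
    and "X \<in> rv_class M \<alpha>"
  shows
    \<comment> \<open>1. model-independence\<close>
    "(\<forall>(N :: 'b measure) Y. prob_space N \<and> Y \<in> borel_measurable N \<and>
          distr N borel Y = distr M borel X \<longrightarrow>
        Q_bound N \<alpha> Y p = Q_bound M \<alpha> X p) \<and>
     \<comment> \<open>2. monotonicity in X\<close>
     (\<forall>(N :: 'b measure) Y. prob_space N \<and> Y \<in> rv_class N \<alpha> \<and> stoch_dom (\<alpha> + 1) M X N Y \<longrightarrow>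
        Q_bound M \<alpha> X p \<le> Q_bound N \<alpha> Y p) \<and>
     (\<forall>\<gamma> (N :: 'b measure) Y. 1 \<le> \<gamma> \<and> \<gamma> \<le> \<alpha> + 1 \<and>
          prob_space N \<and> Y \<in> rv_class N \<alpha> \<and> stoch_dom \<gamma> M X N Y \<longrightarrow>
        Q_bound M \<alpha> X p \<le> Q_bound N \<alpha> Y p) \<and>
     (\<forall>Y \<in> rv_class M \<alpha>. (AE \<omega> in M. X \<omega> \<le> Y \<omega>) \<longrightarrow>
        Q_bound M \<alpha> X p \<le> Q_bound M \<alpha> Y p) \<and>
     \<comment> \<open>3. monotonicity in alpha\<close>
     mono_on {a. X \<in> rv_class M a} (\<lambda>a. Q_bound M a X p) \<and>
     \<comment> \<open>4. monotonicity in p\<close>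
     antimono_on {0<..<1} (\<lambda>q. Q_bound M \<alpha> X q) \<and>
     (0 < \<alpha> \<longrightarrow> strict_antimono_on ({p_star M X..<1} \<inter> {0<..<1}) (\<lambda>q. Q_bound M \<alpha> X q)) \<and>
     \<comment> \<open>5. finiteness\<close>
     \<bar>Q_bound M \<alpha> X p\<bar> \<noteq> \<infinity> \<and>
     \<comment> \<open>6. concavity\<close>
     (0 < \<alpha> \<and> \<alpha> < \<infinity> \<longrightarrow>
        concave_in {0<..<1} (\<lambda>q. q powr (- 1 / enn2real \<alpha>)) (\<lambda>q. Q_bound M \<alpha> X q)) \<and>
     (\<alpha> = \<infinity> \<longrightarrow>
        concave_in {0<..<1} (\<lambda>q. ln (1 / q)) (\<lambda>q. Q_bound M \<alpha> X q)) \<and>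
     \<comment> \<open>7. stability in p\<close>
     (0 < \<alpha> \<longrightarrow> continuous_on {0<..<1} (\<lambda>q. Q_bound M \<alpha> X q)) \<and>
     \<comment> \<open>8. stability in X\<close>
     (\<forall>(N :: nat \<Rightarrow> 'b measure) Xs.
        0 < \<alpha> \<and>
        (\<forall>n. prob_space (N n) \<and> Xs n \<in> rv_class (N n) \<alpha>) \<and>
        weak_conv_m (\<lambda>n. distr (N n) borel (Xs n)) (distr M borel X) \<and>
        (\<alpha> < \<infinity> \<longrightarrow> unif_tail_powr (enn2real \<alpha>) N Xs) \<and>
        (\<alpha> = \<infinity> \<longrightarrow> (\<forall>l \<in> exp_moment_set M X. unif_tail_exp l N Xs)) \<longrightarrow>
        (\<lambda>n. Q_bound (N n) \<alpha> (Xs n) p) \<longlonglongrightarrow> Q_bound M \<alpha> X p) \<and>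
     \<comment> \<open>9. stability in alpha\<close>
     (\<forall>as :: nat \<Rightarrow> ennreal.
        0 < \<alpha> \<and> (\<forall>n. as n < \<infinity>) \<and> as \<longlonglongrightarrow> \<alpha> \<and> X \<in> rv_class M (SUP n. as n) \<longrightarrow>
        (\<lambda>n. Q_bound M (as n) X p) \<longlonglongrightarrow> Q_bound M \<alpha> X p) \<and>
     \<comment> \<open>10. translation invariance\<close>
     (\<forall>c::real. Q_bound M \<alpha> (\<lambda>\<omega>. X \<omega> + c) p = Q_bound M \<alpha> X p + ereal c) \<and>
     \<comment> \<open>11. consistency\<close>
     (\<forall>c::real. Q_bound M \<alpha> (\<lambda>\<omega>. c) p = ereal c) \<and>
     \<comment> \<open>12. sensitivity\<close>
     ((AE \<omega> in M. 0 \<le> X \<omega>) \<longrightarrow>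
        (measure M {\<omega> \<in> space M. 0 < X \<omega>} > 0 \<longrightarrow>
           (\<forall>a. 0 < a \<and> X \<in> rv_class M a \<longrightarrow> 0 < Q_bound M a X p)) \<and>
        (measure M {\<omega> \<in> space M. 0 < X \<omega>} > p \<longrightarrow> 0 < Q_bound M 0 X p)) \<and>
     \<comment> \<open>13. positive homogeneity\<close>
     (\<forall>\<kappa>::real. 0 \<le> \<kappa> \<longrightarrow> Q_bound M \<alpha> (\<lambda>\<omega>. \<kappa> * X \<omega>) p = ereal \<kappa> * Q_bound M \<alpha> X p) \<and>
     \<comment> \<open>14. subadditivity\<close>
     (1 \<le> \<alpha> \<longrightarrow> (\<forall>Y \<in> rv_class M \<alpha>.
        Q_bound M \<alpha> (\<lambda>\<omega>. X \<omega> + Y \<omega>) p \<le> Q_bound M \<alpha> X p + Q_bound M \<alpha> Y p)) \<and>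
     \<comment> \<open>15. convexity\<close>
     (1 \<le> \<alpha> \<longrightarrow> (\<forall>Y \<in> rv_class M \<alpha>. \<forall>t::real. 0 < t \<and> t < 1 \<longrightarrow>
        Q_bound M \<alpha> (\<lambda>\<omega>. (1 - t) * X \<omega> + t * Y \<omega>) p
          \<le> ereal (1 - t) * Q_bound M \<alpha> X p + ereal t * Q_bound M \<alpha> Y p))"
proof (intro conjI allI ballI impI, goal_cases)
  note M = assms(1) and p = assms(2,3) and X = assms(4)
  note Xm = rv_class_measurable[OF X]
  {
    \<comment> \<open>Splitting the conjunction yields twenty goals, since several of the fifteen
      properties have more than one clause; the case numbers therefore run ahead of the property
      numbers.\<close>
    case (1 N Y)
    then show ?case using Q_bound_distr_eq Xm by blast
  next
    case (2 N Y)
    then show ?case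
      using Q_bound_mono_stoch_dom[of "\<alpha> + 1"] Xm rv_class_measurable
      by (metis add.commute add_increasing2 order_refl zero_le)
  next
    case (3 \<gamma> N Y)
    then show ?case using Q_bound_mono_stoch_dom Xm rv_class_measurable by blast
  next
    case (4 Y)
    then show ?case by (intro Q_bound_mono_AE)
  next
    case 5
    show ?case by (intro mono_onI Q_bound_mono_index)
  next
    case 6
    show ?case by (intro monotone_onI Q_bound_antimono)
  next
    case 7
    then show ?case by (intro monotone_onI Q_bound_strict_antimono M X) auto
  next
    case 8
    show ?case by (rule Q_bound_finite[OF M p X])
  next
    case 9
    then have "level_scale \<alpha> = (\<lambda>q. q powr (- 1 / enn2real \<alpha>))"
      by (auto simp: level_scale_def)
    with 9 show ?case using concave_in_Q_bound[OF M _ X] by metis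
  next
    case 10
    then have "level_scale \<alpha> = (\<lambda>q. ln (1 / q))" "0 < \<alpha>"
      by (auto simp: level_scale_def)
    then show ?case using concave_in_Q_bound[OF M _ X] by metis
  next
    case 11
    then show ?case by (rule continuous_on_Q_bound[OF M _ X])
  next
    case (12 N Xs)
    then show ?case using rv_class_measurable by (intro tendsto_Q_bound_distr M X p) blast+
  next
    case (13 as)
    then show ?case by (intro tendsto_Q_bound_index M X p) blast+
  next
    case (14 c)
    show ?case by (rule Q_bound_translate)
  next
    case (15 c)
    show ?case by (rule Q_bound_const[OF M p])
  next
    case (16 a)
    then show ?case using Q_bound_sensitive[OF M _ _ p] by blast
  next
    case 17
    then show ?case by (intro Q_bound_zero_sensitive M Xm)
  next
    case (18 \<kappa>)
    then show ?case by (rule Q_bound_scale[OF M p])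
  next
    case (19 Y)
    then show ?case by (intro Q_bound_subadditive M p X)
  next
    case (20 Y t)
    then show ?case by (intro Q_bound_convex M p X) auto
  }
qed

end
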